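(* Let $s:\mathbb{R}\to\mathbb{C}$ be a sufficiently smooth regular planar curve and let $u,\varepsilon\in\mathbb{R}$. Let $\gamma:\mathbb{Z}\to\mathbb{C}$ be the planar discrete curve sampling $s$ by $\gamma_k=\gamma(k):=s(u+(2k-1)\varepsilon)$, $k\in\mathbb{Z}$. Let $\kappa(u)$ be the (signed) curvature and $N(u)$ the unit normal of $s$ at $u$, and let $k_0,\kappa_0,m_0$ be the discrete curvature circle, the discrete curvature and the discrete curvature center of $\gamma$ at the edge $\gamma_0\gamma_1$. Then, as $\varepsilon\to 0$ (with $\varepsilon\neq 0$): (1) $\kappa_0=|\kappa(u)|+O(\varepsilon^2)$; (2) $m_0=s(u)+\frac{1}{\kappa(u)}N(u)+O(\varepsilon^2)$ (where $\kappa(u)\ne 0$, so that the right-hand side is defined); (3) the point $p_{\gamma_0\gamma_1}=f(\gamma_{-1},\gamma_0,\gamma_1,\gamma_2)$ satisfies $p_{\gamma_0\gamma_1}=s(u)+O(\varepsilon^3)$.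
   Context: Regular means $s'\neq 0$ everywhere; sufficiently smooth means of class $C^k$ with $k$ large enough. Identify $\mathbb{R}^2$ with $\mathbb{C}$. The smooth curvature is $\kappa=\det(s',s'')/\|s'\|^3$ and the unit normal is $N=i\,s'/|s'|$. For pairwise distinct $a,b,c,d\in\mathbb{C}$ put $\mathrm{cr}(a,b,c,d)=\frac{(a-b)(c-d)}{(b-c)(d-a)}$ and $$f(a,b,c,d)=\frac{c(b-a)\sqrt{\mathrm{cr}(c,a,b,d)}+b(c-a)}{(b-a)\sqrt{\mathrm{cr}(c,a,b,d)}+(c-a)}\in\mathbb{C}\cup\{\infty\},$$ with the principal square root (value $\infty$ when the denominator vanishes). The four points $f(d,a,b,c),\ f(a,b,c,d),\ f(b,c,d,a),\ f(c,d,a,b)$ always lie on a common circle (a line together with $\infty$ counts as a circle, of curvature $0$). For a planar discrete curve $\gamma:\mathbb{Z}\to\mathbb{C}$ with any four consecutive vertices pairwise distinct, the discrete curvature circle $k_i$ at the edge $\gamma_i\gamma_{i+1}$ is this circle for $(a,b,c,d)=(\gamma_{i-1},\gamma_i,\gamma_{i+1},\gamma_{i+2})$; the discrete curvature $\kappa_i$ is the inverse of its radius, and the discrete curvature center $m_i$ is its center. For a regular curve $s$ and sufficiently small $\varepsilon\neq0$ the four sampled points $\gamma_{-1},\gamma_0,\gamma_1,\gamma_2$ are pairwise distinct. *)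

theory Defs
  imports "HOL-Analysis.Analysis" "HOL-Library.Landau_Symbols"
begin

section \<open>Smooth planar curves\<close>

abbreviation velocity :: "(real \<Rightarrow> complex) \<Rightarrow> real \<Rightarrow> complex" where
  "velocity s \<equiv> \<lambda>t. vector_derivative s (at t)"

primrec class_C :: "nat \<Rightarrow> (real \<Rightarrow> complex) \<Rightarrow> bool" where
  "class_C 0 s \<longleftrightarrow> continuous_on UNIV s"
| "class_C (Suc k) s \<longleftrightarrow> (\<forall>t. s differentiable (at t)) \<and> class_C k (velocity s)"

definition regular_curve :: "(real \<Rightarrow> complex) \<Rightarrow> bool" where
  "regular_curve s \<longleftrightarrow> (\<forall>t. velocity s t \<noteq> 0)"

definition det2 :: "complex \<Rightarrow> complex \<Rightarrow> real" where
  "det2 v w = Re v * Im w - Im v * Re w"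

definition curvature :: "(real \<Rightarrow> complex) \<Rightarrow> real \<Rightarrow> real" where
  "curvature s u = det2 (velocity s u) (velocity (velocity s) u) / norm (velocity s u) ^ 3"

definition unit_normal :: "(real \<Rightarrow> complex) \<Rightarrow> real \<Rightarrow> complex" where
  "unit_normal s u = \<i> * velocity s u / of_real (norm (velocity s u))"


section \<open>Circles in the extended plane\<close>

text \<open>
  The extended plane is \<^typ>\<open>complex option\<close>, with \<^term>\<open>None\<close> as the point at infinity.
\<close>

definition proper_circle :: "complex \<Rightarrow> real \<Rightarrow> complex option set" where
  "proper_circle c r = Some ` sphere c r"

definition extended_line :: "complex \<Rightarrow> complex \<Rightarrow> complex option set" where
  "extended_line p v = insert None (Some ` range (\<lambda>t::real. p + of_real t * v))"

definition is_circle :: "complex option set \<Rightarrow> bool" where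
  "is_circle K \<longleftrightarrow>
     (\<exists>c r. r > 0 \<and> K = proper_circle c r) \<or> (\<exists>p v. v \<noteq> 0 \<and> K = extended_line p v)"

definition circle_curvature :: "complex option set \<Rightarrow> real" where
  "circle_curvature K =
     (if \<exists>c r. r > 0 \<and> K = proper_circle c r
      then 1 / (THE r. r > 0 \<and> (\<exists>c. K = proper_circle c r)) else 0)"

text \<open>A line has no center in the plane; its center is \<^term>\<open>None\<close>.\<close>

definition circle_center :: "complex option set \<Rightarrow> complex option" where
  "circle_center K =
     (if \<exists>c r. r > 0 \<and> K = proper_circle c r
      then Some (THE c. \<exists>r>0. K = proper_circle c r) else None)"


section \<open>Discrete curves\<close>

definition cross_ratio :: "complex \<Rightarrow> complex \<Rightarrow> complex \<Rightarrow> complex \<Rightarrow> complex" where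
  "cross_ratio a b c d = ((a - b) * (c - d)) / ((b - c) * (d - a))"

definition f_pt :: "complex \<Rightarrow> complex \<Rightarrow> complex \<Rightarrow> complex \<Rightarrow> complex option" where
  "f_pt a b c d =
     (let q = csqrt (cross_ratio c a b d); D = (b - a) * q + (c - a)
      in if D = 0 then None else Some ((c * (b - a) * q + b * (c - a)) / D))"

text \<open>
  For pairwise distinct \<open>a b c d\<close> the four points below are pairwise distinct and concyclic
  (in pairs they are the fixed points of two commuting involutions), so the
  circle through them is unique.
\<close>

definition four_point_circle ::
    "complex \<Rightarrow> complex \<Rightarrow> complex \<Rightarrow> complex \<Rightarrow> complex option set" where
  "four_point_circle a b c d =
     (THE K. is_circle K \<and> {f_pt d a b c, f_pt a b c d, f_pt b c d a, f_pt c d a b} \<subseteq> K)"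

definition discrete_curvature_circle :: "(int \<Rightarrow> complex) \<Rightarrow> int \<Rightarrow> complex option set" where
  "discrete_curvature_circle \<gamma> i =
     four_point_circle (\<gamma> (i - 1)) (\<gamma> i) (\<gamma> (i + 1)) (\<gamma> (i + 2))"

definition discrete_curvature :: "(int \<Rightarrow> complex) \<Rightarrow> int \<Rightarrow> real" where
  "discrete_curvature \<gamma> i = circle_curvature (discrete_curvature_circle \<gamma> i)"

definition discrete_center :: "(int \<Rightarrow> complex) \<Rightarrow> int \<Rightarrow> complex option" where
  "discrete_center \<gamma> i = circle_center (discrete_curvature_circle \<gamma> i)"

definition edge_point :: "(int \<Rightarrow> complex) \<Rightarrow> int \<Rightarrow> complex option" where
  "edge_point \<gamma> i = f_pt (\<gamma> (i - 1)) (\<gamma> i) (\<gamma> (i + 1)) (\<gamma> (i + 2))"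

definition sampling :: "(real \<Rightarrow> complex) \<Rightarrow> real \<Rightarrow> real \<Rightarrow> int \<Rightarrow> complex" where
  "sampling s u \<epsilon> = (\<lambda>k. s (u + (2 * of_int k - 1) * \<epsilon>))"

text \<open>
  \<open>g = z + O(h)\<close> at 0 for a function with values in the extended plane; in
  particular \<open>g\<close> is finite near 0.
\<close>

definition ext_approx :: "(real \<Rightarrow> complex option) \<Rightarrow> complex \<Rightarrow> (real \<Rightarrow> real) \<Rightarrow> bool" where
  "ext_approx g z h \<longleftrightarrow>
     (\<forall>\<^sub>F \<epsilon> in at 0. g \<epsilon> \<noteq> None) \<and>
     (\<lambda>\<epsilon>. the (g \<epsilon>) - z) \<in> O[at 0](\<lambda>\<epsilon>. of_real (h \<epsilon>))"

end

theory Submission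
  imports Defs
begin

text \<open>
  Invert the plane about the edge point \<open>p = f(a,b,c,d)\<close>, that is, apply \<open>z \<mapsto> 1 / (z - p)\<close>.
  The points \<open>f(a,b,c,d)\<close> and \<open>f(c,d,a,b)\<close> are the fixed points of the involution that exchanges
  \<open>b\<close> with \<open>c\<close> and \<open>a\<close> with \<open>d\<close>; after the inversion one of them is at infinity and the involution is
  a point reflection, whose center \<open>\<tau>\<close> is the image of \<open>f(c,d,a,b)\<close> and the midpoint of the images of
  \<open>b\<close> and \<open>c\<close>. The involution that exchanges \<open>a\<close> with \<open>b\<close> and \<open>c\<close> with \<open>d\<close> commutes with this
  reflection, which therefore exchanges its fixed points \<open>f(b,c,d,a)\<close> and \<open>f(d,a,b,c)\<close>: their images are
  \<open>\<tau> + \<eta>\<close> and \<open>\<tau> - \<eta>\<close>. Hence the discrete curvature circle is the preimage of the line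
  \<open>\<tau> + \<real> \<eta>\<close>. This gives concyclicity (\<open>inverse_midpoints_coincide\<close>, \<open>f_pt_opposite\<close>), uniqueness
  (\<open>circle_through_three_points\<close>), and closed formulas: the curvature is \<open>2 \<bar>Im (\<tau> cnj \<eta>)\<bar> / \<bar>\<eta>\<bar>\<close> and
  the center is \<open>p - \<i> cnj \<eta> / (2 Im (\<tau> cnj \<eta>))\<close>.

  It remains to expand \<open>p\<close>, \<open>\<tau>\<close> and \<open>\<eta>\<close>. The construction commutes with similarities, so the
  samples may be replaced by \<open>(s(u + x \<epsilon>) - s(u)) / (\<epsilon> s'(u)) = x + \<alpha> x^2 \<epsilon> + \<beta> x^3 \<epsilon>^2 + O(\<epsilon>^3)\<close>
  for \<open>x = -3, -1, 1, 3\<close>, where \<open>\<alpha> = s'' / (2 s')\<close> and \<open>\<beta> = s''' / (6 s')\<close>. For \<open>\<epsilon> = 0\<close> these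
  are the points \<open>-3, -1, 1, 3\<close>, for which \<open>f\<close> yields \<open>0\<close>, \<open>\<infinity>\<close> and \<open>\<plusminus> sqrt 3\<close>. Arithmetic with
  second-order jets shows that \<open>p = O(\<epsilon>^3)\<close>, \<open>\<tau> = - \<alpha> \<epsilon> + O(\<epsilon>^3)\<close> and
  \<open>\<eta> = 1 / sqrt 3 + O(\<epsilon>^2)\<close>: the symmetry of the sampling cancels \<open>\<beta>\<close> and all terms of the wrong
  parity. Since \<open>\<kappa> = 2 Im \<alpha> / \<bar>s'\<bar>\<close>, inserting these expansions into the formulas for curvature and center
  gives the claim. Neither the absolute value nor the case \<open>\<kappa> = 0\<close> disturbs the estimate of the curvature,
  because \<open>\<bar>_\<bar>\<close> is 1-Lipschitz and lines are included in the formula as circles with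
  \<open>Im (\<tau> cnj \<eta>) = 0\<close>.
\<close>

section \<open>Circles through a base point\<close>

text \<open>
  Circles and lines through \<open>P\<close> in one family. The equation is the usual Hermitian one
  centered at \<open>P\<close>, so that its constant term is zero; the lines are the case \<open>A = 0\<close>, and only they contain
  infinity. Only \<open>B \<noteq> 0\<close> gives a circle.
\<close>

definition circle_through :: "complex \<Rightarrow> real \<Rightarrow> complex \<Rightarrow> complex option set" where
  "circle_through P A B =
     {Some z | z. A * (cmod (z - P))\<^sup>2 + Re (cnj B * (z - P)) = 0} \<union> {x. x = None \<and> A = 0}"

lemma Some_in_circle_through:
  "Some z \<in> circle_through P A B \<longleftrightarrow> A * (cmod (z - P))\<^sup>2 + Re (cnj B * (z - P)) = 0"
  by (auto simp: circle_through_def)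

lemma None_in_circle_through: "None \<in> circle_through P A B \<longleftrightarrow> A = 0"
  by (auto simp: circle_through_def)

lemma base_in_circle_through: "Some P \<in> circle_through P A B"
  by (simp add: Some_in_circle_through)

text \<open>
  In the coordinate \<open>1 / (z - P)\<close> the circle becomes the line \<open>A + Re (B \<cdot> _) = 0\<close>. All incidence
  questions below are settled in this coordinate.
\<close>

lemma circle_through_inverse:
  assumes "w \<noteq> 0"
  shows "Some (P + w) \<in> circle_through P A B \<longleftrightarrow> A + Re (B / w) = 0"
proof -
  have "A * (cmod w)\<^sup>2 + Re (cnj B * w) = (cmod w)\<^sup>2 * (A + Re (B / w))"
    using assms by (simp add: complex_div_cnj[of B w] Re_divide_of_real field_simps del: of_real_power)
  with assms show ?thesis
    by (simp add: Some_in_circle_through)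
qed

lemma circle_through_scale:
  assumes "t \<noteq> 0"
  shows "circle_through P (t * A) (of_real t * B) = circle_through P A B"
proof -
  have "t * A * x + Re (cnj (of_real t * B) * y) = t * (A * x + Re (cnj B * y))" for x y
    by (simp add: algebra_simps)
  then have "t * A * x + Re (cnj (of_real t * B) * y) = 0 \<longleftrightarrow> A * x + Re (cnj B * y) = 0" for x y
    using assms by (metis mult_eq_0_iff)
  with assms show ?thesis
    unfolding circle_through_def by (simp only: mult_eq_0_iff simp_thms)
qed

lemma circle_through_eq_proper_circle:
  assumes "A \<noteq> 0" "B \<noteq> 0"
  shows "circle_through P A B = proper_circle (P - B / of_real (2 * A)) (cmod B / (2 * \<bar>A\<bar>))"
proof -
  have "A * (cmod (z - P))\<^sup>2 + Re (cnj B * (z - P)) = 0 \<longleftrightarrow>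
        dist (P - B / of_real (2 * A)) z = cmod B / (2 * \<bar>A\<bar>)" for z
  proof -
    have "(dist (P - B / of_real (2 * A)) z)\<^sup>2 = (cmod ((z - P) + B / of_real (2 * A)))\<^sup>2"
      by (simp add: dist_norm norm_minus_commute algebra_simps)
    also have "\<dots> = (cmod (z - P))\<^sup>2 + (cmod (B / of_real (2 * A)))\<^sup>2
        + 2 * ((z - P) \<bullet> (B / of_real (2 * A)))"
      by (simp only: dot_norm) (simp add: field_simps)
    also have "cmod (B / of_real (2 * A)) = cmod B / (2 * \<bar>A\<bar>)"
      by (simp add: norm_divide norm_mult)
    also have "2 * ((z - P) \<bullet> (B / of_real (2 * A))) = Re (cnj B * (z - P)) / A"
      using assms by (simp add: inner_complex_def Re_divide_of_real Im_divide_of_real field_simps del: of_real_mult)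
    also have "(cmod (z - P))\<^sup>2 + (cmod B / (2 * \<bar>A\<bar>))\<^sup>2 + Re (cnj B * (z - P)) / A
        = (cmod B / (2 * \<bar>A\<bar>))\<^sup>2 + (A * (cmod (z - P))\<^sup>2 + Re (cnj B * (z - P))) / A"
      using assms by (simp add: add_divide_distrib)
    finally have "(dist (P - B / of_real (2 * A)) z)\<^sup>2 = (cmod B / (2 * \<bar>A\<bar>))\<^sup>2 \<longleftrightarrow>
      A * (cmod (z - P))\<^sup>2 + Re (cnj B * (z - P)) = 0"
      using assms by simp
    then show ?thesis
      by (simp add: power2_eq_iff_nonneg)
  qed
  with assms show ?thesis
    by (auto simp: circle_through_def proper_circle_def)
qed

lemma circle_through_eq_extended_line:
  assumes "B \<noteq> 0"
  shows "circle_through P 0 B = extended_line P (\<i> * B)"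
proof -
  have "Re (cnj B * (z - P)) = 0 \<longleftrightarrow> (\<exists>t::real. z = P + of_real t * (\<i> * B))" for z
  proof
    assume *: "Re (cnj B * (z - P)) = 0"
    define t where "t = Im (cnj B * (z - P)) / (cmod B)\<^sup>2"
    have "cnj B * (z - P) = \<i> * of_real (Im (cnj B * (z - P)))"
      using * by (simp add: complex_eq_iff)
    then have "B * cnj B * (z - P) = \<i> * B * of_real (Im (cnj B * (z - P)))"
      by (simp add: mult_ac)
    then have "(of_real (cmod B))\<^sup>2 * (z - P) = \<i> * B * of_real (Im (cnj B * (z - P)))"
      by (simp flip: complex_norm_square)
    then have "z = P + of_real t * (\<i> * B)"
      using assms by (simp add: t_def field_simps)
    then show "\<exists>t::real. z = P + of_real t * (\<i> * B)" ..
  qed (auto simp: algebra_simps)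
  then show ?thesis
    by (auto simp: circle_through_def extended_line_def)
qed

lemma is_circle_circle_through:
  assumes "B \<noteq> 0"
  shows "is_circle (circle_through P A B)"
proof (cases "A = 0")
  case True
  then have "circle_through P A B = extended_line P (\<i> * B)" "\<i> * B \<noteq> 0"
    using assms circle_through_eq_extended_line by simp_all
  then show ?thesis
    unfolding is_circle_def by blast
next
  case False
  then have "circle_through P A B = proper_circle (P - B / of_real (2 * A)) (cmod B / (2 * \<bar>A\<bar>))"
    "cmod B / (2 * \<bar>A\<bar>) > 0"
    using assms circle_through_eq_proper_circle by simp_all
  then show ?thesis
    unfolding is_circle_def by blast
qed

text \<open>
  For a circle with center \<open>c\<close> one can take \<open>A = 1\<close> and \<open>B = 2 (P - c)\<close>; for a line, \<open>B\<close> is a normal vector.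
\<close>

lemma is_circle_obtain_circle_through:
  assumes "is_circle K" "Some P \<in> K"
  obtains A B where "B \<noteq> 0" "K = circle_through P A B"
proof -
  from assms(1) consider
      c r where "r > 0" "K = proper_circle c r"
    | p v where "v \<noteq> 0" "K = extended_line p v"
    by (auto simp: is_circle_def)
  then show ?thesis
  proof cases
    case 1
    with assms(2) have P: "cmod (c - P) = r"
      by (auto simp: proper_circle_def dist_norm)
    with 1 have ne: "c \<noteq> P" by auto
    define B where "B = 2 * (P - c)"
    have "P - B / 2 = c" "cmod B / 2 = r"
      unfolding B_def norm_mult using P by (simp_all add: norm_minus_commute field_simps)
    moreover have B: "B \<noteq> 0"
      using ne by (simp add: B_def)
    ultimately have "K = circle_through P 1 B"
      using circle_through_eq_proper_circle[of 1 B P] 1 by simp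
    with B show ?thesis by (rule that)
  next
    case 2
    with assms(2) obtain t where t: "P = p + of_real t * v"
      by (auto simp: extended_line_def)
    have "K = extended_line P v"
    proof -
      have "range (\<lambda>x::real. p + of_real x * v) = range (\<lambda>x::real. P + of_real x * v)"
      proof (intro equalityI image_subsetI)
        fix x :: real
        have "p + of_real x * v = P + of_real (x - t) * v"
          by (simp add: t algebra_simps)
        then show "p + of_real x * v \<in> range (\<lambda>x::real. P + of_real x * v)" by blast
        have "P + of_real x * v = p + of_real (x + t) * v"
          by (simp add: t algebra_simps)
        then show "P + of_real x * v \<in> range (\<lambda>x::real. p + of_real x * v)" by blast
      qed
      with 2 show ?thesis by (simp add: extended_line_def)
    qed
    then have "K = circle_through P 0 (- \<i> * v)"
      using circle_through_eq_extended_line[of "- \<i> * v" P] 2 by simp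
    with 2 that[of "- \<i> * v" 0] show ?thesis by simp
  qed
qed

text \<open>
  If the centers were distinct, the point of the first circle farthest from the other center would
  show that the second radius exceeds the first by the distance of the centers, and conversely.
\<close>

lemma proper_circle_eqD:
  assumes "proper_circle c r = proper_circle c' r'" "r > 0" "r' > 0"
  shows "c = c'" "r = r'"
proof -
  have sph: "sphere c r = sphere c' r'"
    using assms(1) by (simp add: proper_circle_def inj_image_eq_iff)
  have far: "x + cmod (c1 - c2) = y"
    if "sphere c1 x = sphere c2 y" "x > 0" "c1 \<noteq> c2" for c1 c2 :: complex and x y
  proof -
    define e where "e = (c1 - c2) / of_real (cmod (c1 - c2))"
    have e: "cmod e = 1" "c1 - c2 = of_real (cmod (c1 - c2)) * e"
      using that by (auto simp: e_def norm_divide)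
    have "c1 + of_real x * e \<in> sphere c1 x"
      using that(2) e(1) by (simp add: dist_norm norm_mult)
    then have "dist c2 (c1 + of_real x * e) = y"
      unfolding that(1) mem_sphere .
    moreover have "c1 + of_real x * e - c2 = c1 - c2 + of_real x * e"
      by simp
    ultimately have "cmod (c1 - c2 + of_real x * e) = y"
      by (metis dist_norm dist_commute)
    moreover have "c1 - c2 + of_real x * e = of_real (cmod (c1 - c2) + x) * e"
      by (subst (1) e(2)) (simp add: algebra_simps)
    ultimately show ?thesis
      using that(2) e(1) by (simp add: norm_mult del: of_real_add)
  qed
  show "c = c'"
  proof (rule ccontr)
    assume "c \<noteq> c'"
    then have "r + cmod (c - c') = r'" "r' + cmod (c' - c) = r" "cmod (c - c') > 0"
      using far[OF sph] far[OF sph[symmetric]] assms by auto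
    then show False by (simp add: norm_minus_commute)
  qed
  moreover have "c + of_real r \<in> sphere c r"
    using assms(2) by (simp add: dist_norm)
  ultimately have "c + of_real r \<in> sphere c r'"
    unfolding sph by simp
  then show "r = r'"
    using assms(2) by (simp add: dist_norm)
qed

lemma circle_curvature_proper_circle:
  assumes "r > 0"
  shows "circle_curvature (proper_circle c r) = 1 / r"
proof -
  have "(THE r'. r' > 0 \<and> (\<exists>c'. proper_circle c r = proper_circle c' r')) = r"
  proof (rule the_equality)
    fix r' assume "r' > 0 \<and> (\<exists>c'. proper_circle c r = proper_circle c' r')"
    then obtain c' where "proper_circle c r = proper_circle c' r'" "r' > 0" by blast
    then show "r' = r" using proper_circle_eqD(2) assms by metis
  qed (use assms in blast)
  moreover have "\<exists>c' r'. r' > 0 \<and> proper_circle c r = proper_circle c' r'"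
    using assms by blast
  ultimately show ?thesis
    unfolding circle_curvature_def by simp
qed

lemma circle_center_proper_circle:
  assumes "r > 0"
  shows "circle_center (proper_circle c r) = Some c"
proof -
  have "(THE c'. \<exists>r'>0. proper_circle c r = proper_circle c' r') = c"
  proof (rule the_equality)
    fix c' assume "\<exists>r'>0. proper_circle c r = proper_circle c' r'"
    then obtain r' where "proper_circle c r = proper_circle c' r'" "r' > 0" by blast
    then show "c' = c" using proper_circle_eqD(1) assms by metis
  qed (use assms in blast)
  moreover have "\<exists>c' r'. r' > 0 \<and> proper_circle c r = proper_circle c' r'"
    using assms by blast
  ultimately show ?thesis
    unfolding circle_center_def by simp
qed

lemma circle_curvature_circle_through:
  assumes "B \<noteq> 0"
  shows "circle_curvature (circle_through P A B) = 2 * \<bar>A\<bar> / cmod B"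
proof (cases "A = 0")
  case True
  then have "None \<in> circle_through P A B" by (simp add: None_in_circle_through)
  then have line: "\<not> (\<exists>c r. r > 0 \<and> circle_through P A B = proper_circle c r)"
    by (auto simp: proper_circle_def)
  show ?thesis unfolding circle_curvature_def if_not_P[OF line] by (simp add: True)
next
  case False
  with assms show ?thesis
    by (simp add: circle_through_eq_proper_circle circle_curvature_proper_circle)
qed

lemma circle_center_circle_through:
  assumes "A \<noteq> 0" "B \<noteq> 0"
  shows "circle_center (circle_through P A B) = Some (P - B / of_real (2 * A))"
  using assms by (simp add: circle_through_eq_proper_circle circle_center_proper_circle)

text \<open>
  The inverted points \<open>1 / v\<close> and \<open>1 / w\<close> are distinct, so they determine the line
  \<open>A + Re (B \<cdot> _) = 0\<close>, and with it \<open>A\<close> and \<open>B\<close> up to a common real factor. The right-hand side writes this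
  line in terms of its midpoint \<open>\<tau>\<close> and its direction \<open>\<eta>\<close>.
\<close>

lemma circle_through_three_points:
  assumes "v \<noteq> 0" "w \<noteq> 0" "v \<noteq> w" "B \<noteq> 0"
    and "Some (P + v) \<in> circle_through P A B" "Some (P + w) \<in> circle_through P A B"
  defines "\<tau> \<equiv> (1 / v + 1 / w) / 2" and "\<eta> \<equiv> (1 / v - 1 / w) / 2"
  shows "circle_through P A B = circle_through P (Im (\<tau> * cnj \<eta>)) (\<i> * cnj \<eta>)"
proof -
  have \<eta>: "\<eta> \<noteq> 0" using assms by (auto simp: \<eta>_def)
  have vw: "1 / v = \<tau> + \<eta>" "1 / w = \<tau> - \<eta>"
    by (simp_all add: \<tau>_def \<eta>_def field_simps)
  have eqs: "A + Re (B * (\<tau> + \<eta>)) = 0" "A + Re (B * (\<tau> - \<eta>)) = 0"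
    using assms(5,6) circle_through_inverse assms(1,2) by (simp_all flip: vw)
  then have re0: "Re (B * \<eta>) = 0" and A: "A = - Re (B * \<tau>)"
    by (simp_all add: algebra_simps)
  define t where "t = Im (B * \<eta>) / (cmod \<eta>)\<^sup>2"
  have "B * \<eta> = \<i> * of_real (Im (B * \<eta>))"
    using re0 by (simp add: complex_eq_iff)
  then have "B * (\<eta> * cnj \<eta>) = \<i> * of_real (Im (B * \<eta>)) * cnj \<eta>"
    by (simp add: mult.assoc [symmetric])
  then have "B * (of_real (cmod \<eta>))\<^sup>2 = \<i> * of_real (Im (B * \<eta>)) * cnj \<eta>"
    by (simp flip: complex_norm_square)
  then have B: "B = of_real t * (\<i> * cnj \<eta>)"
    using \<eta> by (simp add: t_def field_simps)
  with assms(4) have "t \<noteq> 0" by auto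
  moreover have "A = t * Im (\<tau> * cnj \<eta>)"
    by (simp add: A B algebra_simps)
  ultimately show ?thesis
    using circle_through_scale[of t P "Im (\<tau> * cnj \<eta>)" "\<i> * cnj \<eta>"] B by simp
qed

text \<open>
  The hypothesis on \<open>f_pt c d a b\<close> puts the fourth point at the midpoint \<open>\<tau>\<close> of the inverted second
  and third ones, hence on the circle through the other three; \<open>\<tau> = 0\<close> is the case that the fourth
  point is infinity and the circle is a line.
\<close>

lemma four_point_circle_eq:
  assumes "f_pt a b c d = Some P" "f_pt b c d a = Some (P + v)" "f_pt d a b c = Some (P + w)"
    and vw: "v \<noteq> 0" "w \<noteq> 0" "v \<noteq> w"
  defines "\<tau> \<equiv> (1 / v + 1 / w) / 2" and "\<eta> \<equiv> (1 / v - 1 / w) / 2"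
  assumes "f_pt c d a b = (if \<tau> = 0 then None else Some (P + 1 / \<tau>))"
  shows "four_point_circle a b c d = circle_through P (Im (\<tau> * cnj \<eta>)) (\<i> * cnj \<eta>)"
proof -
  let ?K = "circle_through P (Im (\<tau> * cnj \<eta>)) (\<i> * cnj \<eta>)"
  have B: "\<i> * cnj \<eta> \<noteq> 0" using vw by (simp add: \<eta>_def)
  have 1: "1 / v = \<tau> + \<eta>" "1 / w = \<tau> - \<eta>"
    by (simp_all add: \<tau>_def \<eta>_def field_simps)
  have on: "Im (\<tau> * cnj \<eta>) + Re (\<i> * cnj \<eta> * (\<tau> + of_real t * \<eta>)) = 0" for t
    by (simp add: algebra_simps)
  have mem: "Some (P + z) \<in> ?K" if "z \<noteq> 0" "1 / z = \<tau> + of_real t * \<eta>" for z t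
  proof -
    have "\<i> * cnj \<eta> / z = \<i> * cnj \<eta> * (1 / z)" by simp
    then show ?thesis
      unfolding circle_through_inverse[OF that(1)] that(2) using on by simp
  qed
  have "Some (P + v) \<in> ?K" "Some (P + w) \<in> ?K"
    using mem[of v 1] mem[of w "-1"] vw(1,2) 1 by simp_all
  moreover have "f_pt c d a b \<in> ?K"
  proof (cases "\<tau> = 0")
    case True
    then show ?thesis by (simp add: assms None_in_circle_through)
  next
    case False
    then have "Some (P + 1 / \<tau>) \<in> ?K"
      using mem[of "1 / \<tau>" 0] by simp
    with False show ?thesis by (simp add: assms)
  qed
  ultimately have "is_circle ?K \<and> {f_pt d a b c, f_pt a b c d, f_pt b c d a, f_pt c d a b} \<subseteq> ?K"
    using is_circle_circle_through[OF B] base_in_circle_through assms(1-3) by simp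
  moreover have "K = ?K"
    if "is_circle K \<and> {f_pt d a b c, f_pt a b c d, f_pt b c d a, f_pt c d a b} \<subseteq> K" for K
  proof -
    from that have K: "is_circle K" "Some P \<in> K" "Some (P + v) \<in> K" "Some (P + w) \<in> K"
      using assms(1-3) by auto
    from K(1,2) obtain A B where AB: "B \<noteq> 0" "K = circle_through P A B"
      by (rule is_circle_obtain_circle_through)
    with K(3,4) circle_through_three_points[OF vw AB(1), of P A] show ?thesis
      by (simp add: \<tau>_def \<eta>_def)
  qed
  ultimately show ?thesis
    unfolding four_point_circle_def by (rule the_equality)
qed

section \<open>The points \<open>f\<close> seen from one of them\<close>

text \<open>
  The four points involve only two square roots, because opposite points use the same cross-ratio.
  Below, everything about \<open>q\<close> and \<open>r\<close> is derived from these quadratic equations.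
\<close>

lemma csqrt_cross_ratio_f_pt:
  fixes a b c d :: complex
  assumes distinct: "a \<noteq> b" "a \<noteq> c" "a \<noteq> d" "b \<noteq> c" "b \<noteq> d" "c \<noteq> d"
  defines "q \<equiv> csqrt (cross_ratio c a b d)" and "r \<equiv> csqrt (cross_ratio d b c a)"
  shows "q\<^sup>2 * ((b - a) * (d - c)) = (c - a) * (d - b)" 
    and "r\<^sup>2 * ((c - b) * (d - a)) = (c - a) * (d - b)" 
    and "csqrt (cross_ratio a c d b) = q"
    and "csqrt (cross_ratio b d a c) = r"
proof -
  have "cross_ratio c a b d = (c - a) * (d - b) / ((b - a) * (d - c))"
       "cross_ratio d b c a = (c - a) * (d - b) / ((c - b) * (d - a))"
  proof -
    have "(c - a) * (b - d) = - ((c - a) * (d - b))" "(a - b) * (d - c) = - ((b - a) * (d - c))"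
      "(d - b) * (c - a) = (c - a) * (d - b)" "(b - c) * (a - d) = (c - b) * (d - a)"
      by algebra+
    then show "cross_ratio c a b d = (c - a) * (d - b) / ((b - a) * (d - c))"
       "cross_ratio d b c a = (c - a) * (d - b) / ((c - b) * (d - a))"
      unfolding cross_ratio_def by (simp_all only: minus_divide_divide)
  qed
  with distinct show "q\<^sup>2 * ((b - a) * (d - c)) = (c - a) * (d - b)" 
      "r\<^sup>2 * ((c - b) * (d - a)) = (c - a) * (d - b)"
    by (simp_all add: q_def r_def)
  have "cross_ratio w x y z = cross_ratio x w z y" for w x y z
  proof -
    have "(w - x) * (y - z) = (x - w) * (z - y)" "(x - y) * (z - w) = (w - z) * (y - x)"
      by algebra+
    then show ?thesis unfolding cross_ratio_def by (simp only:)
  qed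
  from this[of a] this[of b]
  have "cross_ratio a c d b = cross_ratio c a b d" "cross_ratio b d a c = cross_ratio d b c a" .
  then show "csqrt (cross_ratio a c d b) = q" "csqrt (cross_ratio b d a c) = r"
    by (simp_all add: q_def r_def)
qed

text \<open>
  With \<open>p = f(a,b,c,d)\<close>, the definition of \<open>f\<close> reads \<open>(p - b) / (c - p) = (b - a) q / (c - a)\<close>, which makes both
  summands explicit.
\<close>

lemma inverse_base_sum:
  fixes a b c q :: complex
  assumes nz: "b \<noteq> a" "c \<noteq> a" "c \<noteq> b" "q \<noteq> 0" and D: "(b - a) * q + (c - a) \<noteq> 0"
  defines "p \<equiv> (c * (b - a) * q + b * (c - a)) / ((b - a) * q + (c - a))"
  shows "1 / (b - p) + 1 / (c - p) =
    ((b - a) * q + (c - a)) * ((b - a) * q - (c - a)) / ((c - b) * (b - a) * (c - a) * q)"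
proof -
  let ?D = "(b - a) * q + (c - a)"
  have pb: "b - p = - ((c - b) * (b - a) * q) / ?D"
    unfolding p_def using D by (simp add: divide_simps) algebra
  have pc: "c - p = (c - b) * (c - a) / ?D"
    unfolding p_def using D by (simp add: divide_simps) algebra
  have "1 / (- (x * y * q) / X) + 1 / (x * z / X) = X * (y * q - z) / (x * y * z * q)"
    if "x \<noteq> 0" "y \<noteq> 0" "z \<noteq> 0" "X \<noteq> 0" for x y z X
    using that nz(4) by (simp add: divide_simps) (simp add: algebra_simps)?
  from this[OF _ _ _ D, of "c - b" "b - a" "c - a"] show ?thesis
    unfolding pb pc using nz by simp
qed

text \<open>
  Here \<open>p\<close>, \<open>v\<close> and \<open>w\<close> are \<open>f(a,b,c,d)\<close>, \<open>f(b,c,d,a)\<close> and \<open>f(d,a,b,c)\<close>. Seen from \<open>p\<close>, the involution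
  that exchanges \<open>b\<close> and \<open>c\<close> is a point reflection, and it exchanges \<open>v\<close> and \<open>w\<close> as well, so both pairs have
  the same midpoint. The proof verifies this by computation: the differences \<open>v - p\<close> and \<open>w - p\<close> factor
  with the common factor \<open>q + r + q r\<close>.
\<close>

lemma inverse_midpoints_coincide:
  fixes a b c d q r :: complex
  assumes distinct: "a \<noteq> b" "a \<noteq> c" "a \<noteq> d" "b \<noteq> c" "b \<noteq> d" "c \<noteq> d"
    and q: "q\<^sup>2 * ((b - a) * (d - c)) = (c - a) * (d - b)" 
    and r: "r\<^sup>2 * ((c - b) * (d - a)) = (c - a) * (d - b)" 
    and D: "(b - a) * q + (c - a) \<noteq> 0" "(c - b) * r + (d - b) \<noteq> 0" "(a - d) * r + (b - d) \<noteq> 0"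
  defines "p \<equiv> (c * (b - a) * q + b * (c - a)) / ((b - a) * q + (c - a))"
    and "v \<equiv> (d * (c - b) * r + c * (d - b)) / ((c - b) * r + (d - b))"
    and "w \<equiv> (b * (a - d) * r + a * (b - d)) / ((a - d) * r + (b - d))"
  assumes "v \<noteq> p"
  shows "1 / (v - p) + 1 / (w - p) = 1 / (b - p) + 1 / (c - p)"
proof -
  let ?D = "(b - a) * q + (c - a)" and ?M = "(b - a) * (d - c)" and ?K = "(c - b) * (d - a)"
    and ?e = "q + r + q * r"
  let ?Dv = "(c - b) * r + (d - b)" and ?Dw = "(d - a) * r + (d - b)"
  have nz: "b - a \<noteq> 0" "c - a \<noteq> 0" "d - a \<noteq> 0" "c - b \<noteq> 0" "d - b \<noteq> 0" "d - c \<noteq> 0" "q \<noteq> 0" "r \<noteq> 0"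
    using distinct q r by auto
  have Dw: "?Dw \<noteq> 0"
  proof
    assume "?Dw = 0"
    then have "(a - d) * r + (b - d) = 0" by algebra
    with D show False by simp
  qed
  have tau: "1 / (b - p) + 1 / (c - p) = ?D * ((b - a) * q - (c - a)) / ((c - b) * (b - a) * (c - a) * q)"
    unfolding p_def using distinct nz D by (intro inverse_base_sum) auto
  have vp: "v - p = (c - b) * q * ?M * ?e / (?D * ?Dv)"
  proof -
    have "(d * (c - b) * r + c * (d - b)) * ?D - (c * (b - a) * q + b * (c - a)) * ?Dv = (c - b) * q * ?M * ?e"
      using q by algebra
    then show ?thesis
      unfolding v_def p_def using D by (simp add: diff_frac_eq mult.commute)
  qed
  with \<open>v \<noteq> p\<close> have e: "?e \<noteq> 0" by auto
  have wp: "w - p = - ((b - a) * ?K * r * ?e) / (?D * ?Dw)"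
  proof -
    have w: "w = - (b * (a - d) * r + a * (b - d)) / ?Dw"
      unfolding w_def using D Dw by (simp add: divide_simps) algebra
    have "- (b * (a - d) * r + a * (b - d)) * ?D - (c * (b - a) * q + b * (c - a)) * ?Dw = - ((b - a) * ?K * r * ?e)"
      using r by algebra
    then show ?thesis
      unfolding w p_def using D Dw by (simp add: diff_frac_eq mult.commute)
  qed
  have key: "?Dv / (d - c) - q * ?Dw / ((d - a) * r) = ?e * ((b - a) * q - (c - a)) / (c - a)"
  proof -
    (* In terms of k, the two equations for the roots give every ratio that occurs
       as a polynomial in q, r and k. *)
    define k where "k = (b - a) / (c - a)"
    have k1: "(d - b) / (d - c) = q\<^sup>2 * k"
      unfolding k_def using q nz by (simp add: frac_eq_eq mult_ac)
    have "(c - b) / (d - c) = (d - b) / (d - c) - (d - c) / (d - c)"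
      unfolding diff_divide_distrib[symmetric] by simp
    with k1 have k2: "(c - b) / (d - c) = q\<^sup>2 * k - 1"
      using nz by simp
    have "(c - b) / (c - a) = (c - a) / (c - a) - (b - a) / (c - a)"
      unfolding diff_divide_distrib[symmetric] by simp
    then have k3: "(c - b) / (c - a) = 1 - k"
      using nz by (simp add: k_def)
    have "(d - b) / (d - a) = r\<^sup>2 * ((c - b) / (c - a))"
      using r nz by (simp add: frac_eq_eq mult_ac)
    then have k4: "(d - b) / (d - a) = r\<^sup>2 * (1 - k)"
      unfolding k3 .
    have "?Dv / (d - c) = (c - b) / (d - c) * r + (d - b) / (d - c)"
      by (simp add: add_divide_distrib)
    then have k5: "?Dv / (d - c) = (q\<^sup>2 * k - 1) * r + q\<^sup>2 * k"
      unfolding k1 k2 .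
    have "q * ?Dw / ((d - a) * r) = (q / r) * (?Dw / (d - a))"
      by (simp add: mult_ac)
    also have "?Dw / (d - a) = r + r\<^sup>2 * (1 - k)"
      unfolding add_divide_distrib k4 using nz by simp
    also have "q / r * (r + r\<^sup>2 * (1 - k)) = q + q * r * (1 - k)"
      using nz by (simp add: distrib_left power2_eq_square)
    finally have k6: "q * ?Dw / ((d - a) * r) = q + q * r * (1 - k)" .
    have "e * (x * q - y) / y = e * (x / y * q - y / y)" for e x y :: complex
      by (cases "y = 0") (simp_all add: field_simps)
    then have "?e * ((b - a) * q - (c - a)) / (c - a) = ?e * ((b - a) / (c - a) * q - (c - a) / (c - a))" .
    then have k7: "?e * ((b - a) * q - (c - a)) / (c - a) = ?e * (k * q - 1)"
      using nz by (simp add: k_def)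
    show ?thesis
      unfolding k5 k6 k7 by algebra
  qed
  have inv_sum: "1 / (cb * q * (ba * dc) * e / (X * Y)) + 1 / (- (ba * (cb * da) * r * e) / (X * Z))
      = X / (e * (ba * cb * q)) * (Y / dc - q * Z / (da * r))"
    if "cb \<noteq> 0" "ba \<noteq> 0" "dc \<noteq> 0" "da \<noteq> 0" "e \<noteq> 0" "X \<noteq> 0" "Y \<noteq> 0" "Z \<noteq> 0"
    for cb ba dc da e X Y Z
  proof -
    have "1 / (cb * q * (ba * dc) * e / (X * Y)) = X / (e * (ba * cb * q)) * (Y / dc)"
      by (simp add: mult_ac)
    moreover have "1 / (- (ba * (cb * da) * r * e) / (X * Z)) = - (X / (e * (ba * cb * q)) * (q * Z / (da * r)))"
      using nz by (simp add: mult_ac)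
    ultimately show ?thesis
      unfolding right_diff_distrib by simp
  qed
  have "1 / (v - p) + 1 / (w - p) = ?D / (?e * ((b - a) * (c - b) * q)) * (?Dv / (d - c) - q * ?Dw / ((d - a) * r))"
    unfolding vp wp by (rule inv_sum) (fact nz D Dw e)+
  also have "\<dots> = ?D / (?e * ((b - a) * (c - b) * q)) * (?e * ((b - a) * q - (c - a)) / (c - a))"
    unfolding key ..
  also have "\<dots> = ?D * ((b - a) * q - (c - a)) / ((c - b) * (b - a) * (c - a) * q)"
  proof -
    have "X / (e * Y) * (e * Z / W) = X * Z / (Y * W)" if "e \<noteq> 0" for X Y Z W e :: complex
      using that by simp
    from this[OF e, of ?D "(b - a) * (c - b) * q" "(b - a) * q - (c - a)" "c - a"] show ?thesis by (simp only: mult_ac)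
  qed
  finally show "1 / (v - p) + 1 / (w - p) = 1 / (b - p) + 1 / (c - p)"
    using tau by simp
qed

text \<open>
  The center of the point reflection described above is its second fixed point. The denominator of
  \<open>f(c,d,a,b)\<close> is a factor of \<open>\<tau>\<close>, so the point is infinite exactly if \<open>\<tau> = 0\<close>.
\<close>

lemma f_pt_opposite:
  fixes a b c d :: complex
  assumes distinct: "a \<noteq> b" "a \<noteq> c" "a \<noteq> d" "b \<noteq> c" "b \<noteq> d" "c \<noteq> d"
    and p: "f_pt a b c d = Some p"
  defines "\<tau> \<equiv> (1 / (b - p) + 1 / (c - p)) / 2"
  shows "f_pt c d a b = (if \<tau> = 0 then None else Some (p + 1 / \<tau>))"
proof -
  define q where "q = csqrt (cross_ratio c a b d)"
  let ?D = "(b - a) * q + (c - a)" and ?D' = "(d - c) * q + (a - c)"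
  let ?E = "(c - a) * (b - a) * (d - c) * q * (1 + q)"
  have q: "q\<^sup>2 * ((b - a) * (d - c)) = (c - a) * (d - b)" "csqrt (cross_ratio a c d b) = q"
    using csqrt_cross_ratio_f_pt(1,3)[OF distinct] by (simp_all add: q_def)
  have nz: "b - a \<noteq> 0" "c - a \<noteq> 0" "d - a \<noteq> 0" "c - b \<noteq> 0" "d - b \<noteq> 0" "d - c \<noteq> 0" "q \<noteq> 0"
    using distinct q by auto
  have q1: "1 + q \<noteq> 0"
  proof
    assume "1 + q = 0"
    then have "q\<^sup>2 = 1" by algebra
    then have "(c - b) * (d - a) = 0" using q by algebra
    with nz show False by simp
  qed
  have D: "?D \<noteq> 0" and p: "p = (c * (b - a) * q + b * (c - a)) / ?D"
    using p by (auto simp: f_pt_def Let_def q_def split: if_splits)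
  have tau: "\<tau> = - (?D * ?D') / (2 * ?E)"
  proof -
    have "2 * \<tau> = ?D * ((b - a) * q - (c - a)) / ((c - b) * (b - a) * (c - a) * q)"
      using inverse_base_sum[of b a c q] distinct nz D by (simp add: \<tau>_def p)
    moreover have "?D * ((b - a) * q - (c - a)) * ?E = - (?D * ?D') * ((c - b) * (b - a) * (c - a) * q)"
    proof -
      have "((b - a) * q - (c - a)) * (d - c) * (1 + q) = - (c - b) * ?D'"
        using q(1) by algebra
      moreover have "D * Y * (ca * ba * dc * q * (1 + q)) = - (D * D') * (cb * ba * ca * q)"
        if "Y * dc * (1 + q) = - cb * D'" for D D' Y ca ba dc cb
        using that by algebra
      ultimately show ?thesis by blast
    qed
    moreover have "(c - b) * (b - a) * (c - a) * q \<noteq> 0" "?E \<noteq> 0"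
      using nz q1 by simp_all
    moreover have "X = W / E" if "X = Y / Z" "Y * E = W * Z" "Z \<noteq> 0" "E \<noteq> 0" for X Y Z E W :: complex
      using that by (simp add: frac_eq_eq)
    ultimately have "2 * \<tau> = - (?D * ?D') / ?E"
      by blast
    moreover have "X = W / (2 * E)" if "2 * X = W / E" for X W E :: complex
    proof -
      have "X = 2 * X / 2" by simp
      also have "\<dots> = W / (2 * E)" unfolding that by simp
      finally show ?thesis .
    qed
    ultimately show ?thesis by blast
  qed
  have zero: "\<tau> = 0 \<longleftrightarrow> ?D' = 0"
    unfolding tau using D nz q1 by simp
  have "(a * (d - c) * q + d * (a - c)) / ?D' = p + 1 / \<tau>" if "?D' \<noteq> 0"
  proof -
    have eq: "(a * (d - c) * q + d * (a - c)) * ?D - (c * (b - a) * q + b * (c - a)) * ?D' = - (2 * ?E)"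
      using q(1) by algebra
    have "(a * (d - c) * q + d * (a - c)) / ?D' - p = - (2 * ?E) / (?D' * ?D)"
      unfolding p diff_frac_eq[OF that D] eq ..
    moreover have "1 / \<tau> = - (2 * ?E) / (?D' * ?D)"
    proof -
      have "1 / (- (X * Y) / Z) = - Z / (Y * X)" for X Y Z :: complex
        by (simp add: mult.commute)
      then show ?thesis unfolding tau .
    qed
    ultimately show ?thesis by (simp add: algebra_simps)
  qed
  with zero show ?thesis
    unfolding f_pt_def Let_def q(2) by auto
qed

lemma cross_ratio_affine:
  assumes "l \<noteq> 0"
  shows "cross_ratio (m + l * a) (m + l * b) (m + l * c) (m + l * d) = cross_ratio a b c d"
proof -
  have "m + l * x - (m + l * y) = l * (x - y)" for x y
    by (simp add: algebra_simps)
  with assms show ?thesis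
    unfolding cross_ratio_def by simp
qed

lemma f_pt_affine:
  assumes "l \<noteq> 0"
  shows "f_pt (m + l * a) (m + l * b) (m + l * c) (m + l * d) = map_option (\<lambda>z. m + l * z) (f_pt a b c d)"
proof -
  let ?q = "csqrt (cross_ratio c a b d)"
  let ?N = "c * (b - a) * ?q + b * (c - a)" and ?D = "(b - a) * ?q + (c - a)"
  have d: "m + l * x - (m + l * y) = l * (x - y)" for x y
    by (simp add: algebra_simps)
  have D: "l * (b - a) * ?q + l * (c - a) = l * ?D"
    and N: "(m + l * c) * (l * (b - a)) * ?q + (m + l * b) * (l * (c - a)) = l * (m * ?D + l * ?N)"
    by (simp_all add: algebra_simps)
  have "l * (m * ?D + l * ?N) / (l * ?D) = m + l * (?N / ?D)" if "?D \<noteq> 0"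
  proof -
    have "l * (m * X + l * Y) / (l * X) = m + l * (Y / X)" if "X \<noteq> 0" for X Y
      using that assms by (simp add: field_simps)
    with that show ?thesis by blast
  qed
  then show ?thesis
    unfolding f_pt_def Let_def cross_ratio_affine[OF assms] d D N using assms by auto
qed

section \<open>Agreement up to a power of the parameter\<close>

text \<open>
  A congruence with respect to the arithmetic operations, as long as the functions converge at 0.
  The value type is kept general so that the final estimates can pass from complex to real functions.
\<close>

definition agree_to_order :: "nat \<Rightarrow> (real \<Rightarrow> 'a::real_normed_field) \<Rightarrow> (real \<Rightarrow> 'a) \<Rightarrow> bool" where
  "agree_to_order n f g \<longleftrightarrow> (\<lambda>\<epsilon>. f \<epsilon> - g \<epsilon>) \<in> O[at 0](\<lambda>\<epsilon>. of_real (\<epsilon> ^ n))"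

lemma agree_to_order_refl [simp]: "agree_to_order n f f"
  by (simp add: agree_to_order_def)

lemma agree_to_order_trans:
  assumes "agree_to_order n f g" "agree_to_order n g h"
  shows "agree_to_order n f h"
  using sum_in_bigo(1)[OF assms[unfolded agree_to_order_def]] by (simp add: agree_to_order_def)

lemma agree_to_order_sym:
  assumes "agree_to_order n f g"
  shows "agree_to_order n g f"
  using assms by (simp add: agree_to_order_def landau_o.big.uminus_in_iff flip: landau_o.big.uminus_in_iff[of "\<lambda>x. f x - g x"])

lemma agree_to_order_add:
  assumes "agree_to_order n f f'" "agree_to_order n g g'"
  shows "agree_to_order n (\<lambda>\<epsilon>. f \<epsilon> + g \<epsilon>) (\<lambda>\<epsilon>. f' \<epsilon> + g' \<epsilon>)"
  using sum_in_bigo(1)[OF assms[unfolded agree_to_order_def]]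
  by (simp add: agree_to_order_def algebra_simps)

lemma agree_to_order_diff:
  assumes "agree_to_order n f f'" "agree_to_order n g g'"
  shows "agree_to_order n (\<lambda>\<epsilon>. f \<epsilon> - g \<epsilon>) (\<lambda>\<epsilon>. f' \<epsilon> - g' \<epsilon>)"
  using sum_in_bigo(2)[OF assms[unfolded agree_to_order_def]]
  by (simp add: agree_to_order_def algebra_simps)

lemma tendsto_bigo_1:
  fixes f :: "real \<Rightarrow> 'a::real_normed_field"
  assumes "(f \<longlongrightarrow> c) (at 0)"
  shows "f \<in> O[at 0](\<lambda>_. 1)"
  using assms by (intro bigoI_tendsto[of _ _ c]) simp_all

lemma mult_bounded_bigo:
  fixes f g :: "real \<Rightarrow> 'a::real_normed_field"
  assumes "f \<in> O[at 0](h)" "(g \<longlongrightarrow> c) (at 0)"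
  shows "(\<lambda>\<epsilon>. f \<epsilon> * g \<epsilon>) \<in> O[at 0](h)"
  using landau_o.big.mult[OF assms(1) tendsto_bigo_1[OF assms(2)]] by simp

lemma agree_to_order_tendsto:
  assumes "agree_to_order n f g" "n > 0" "(g \<longlongrightarrow> c) (at 0)"
  shows "(f \<longlongrightarrow> c) (at 0)"
proof -
  have "((\<lambda>\<epsilon>. of_real (\<epsilon> ^ n) :: 'a) \<longlongrightarrow> of_real (0 ^ n)) (at 0)"
    by (intro tendsto_intros)
  then have "(\<lambda>\<epsilon>. of_real (\<epsilon> ^ n) :: 'a) \<in> o[at 0](\<lambda>_. 1)"
    using assms(2) by (intro smalloI_tendsto) (simp_all add: power_0_left)
  with assms(1) have "(\<lambda>\<epsilon>. f \<epsilon> - g \<epsilon>) \<in> o[at 0](\<lambda>_. 1)"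
    unfolding agree_to_order_def by (rule landau_o.big_small_trans)
  then have "((\<lambda>\<epsilon>. f \<epsilon> - g \<epsilon>) \<longlongrightarrow> 0) (at 0)"
    by (auto dest: smalloD_tendsto)
  from tendsto_add[OF this assms(3)] show ?thesis by simp
qed

lemma agree_to_order_mult:
  assumes "agree_to_order n f f'" "agree_to_order n g g'" "n > 0"
    and "(f' \<longlongrightarrow> x) (at 0)" "(g' \<longlongrightarrow> y) (at 0)"
  shows "agree_to_order n (\<lambda>\<epsilon>. f \<epsilon> * g \<epsilon>) (\<lambda>\<epsilon>. f' \<epsilon> * g' \<epsilon>)"
proof -
  have "(g \<longlongrightarrow> y) (at 0)" using agree_to_order_tendsto assms by blast
  then have "(\<lambda>\<epsilon>. (f \<epsilon> - f' \<epsilon>) * g \<epsilon> + (g \<epsilon> - g' \<epsilon>) * f' \<epsilon>) \<in> O[at 0](\<lambda>\<epsilon>. of_real (\<epsilon> ^ n))"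
    using assms unfolding agree_to_order_def by (intro sum_in_bigo(1) mult_bounded_bigo)
  then show ?thesis by (simp add: agree_to_order_def algebra_simps)
qed

lemma agree_to_order_divide:
  assumes "agree_to_order n f f'" "agree_to_order n g g'" "n > 0"
    and "(f' \<longlongrightarrow> x) (at 0)" "(g' \<longlongrightarrow> y) (at 0)" "y \<noteq> 0"
  shows "agree_to_order n (\<lambda>\<epsilon>. f \<epsilon> / g \<epsilon>) (\<lambda>\<epsilon>. f' \<epsilon> / g' \<epsilon>)"
proof -
  have g: "(g \<longlongrightarrow> y) (at 0)" using agree_to_order_tendsto assms by blast
  have "(\<lambda>\<epsilon>. (g' \<epsilon> - g \<epsilon>) * (1 / (g \<epsilon> * g' \<epsilon>))) \<in> O[at 0](\<lambda>\<epsilon>. of_real (\<epsilon> ^ n))"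
    using assms g agree_to_order_sym[OF assms(2)] unfolding agree_to_order_def
    by (intro mult_bounded_bigo[where c = "1 / (y * y)"] tendsto_intros) auto
  moreover have "eventually (\<lambda>\<epsilon>. (g' \<epsilon> - g \<epsilon>) * (1 / (g \<epsilon> * g' \<epsilon>)) = 1 / g \<epsilon> - 1 / g' \<epsilon>) (at 0)"
    using tendsto_imp_eventually_ne[OF g assms(6)] tendsto_imp_eventually_ne[OF assms(5,6)]
    by eventually_elim (simp add: field_simps)
  ultimately have "agree_to_order n (\<lambda>\<epsilon>. 1 / g \<epsilon>) (\<lambda>\<epsilon>. 1 / g' \<epsilon>)"
    unfolding agree_to_order_def by (subst (asm) landau_o.big.in_cong)
  from agree_to_order_mult[OF assms(1) this assms(3,4) tendsto_divide[OF tendsto_const assms(5,6)]]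
  show ?thesis by simp
qed

text \<open>
  From \<open>csqrt f - g = (f - g^2) / (csqrt f + g)\<close>, where the denominator tends to \<open>2 c \<noteq> 0\<close>. The
  condition \<open>Re c > 0\<close> makes the principal root select \<open>g\<close> and not \<open>- g\<close>.
\<close>

lemma agree_to_order_csqrt:
  assumes "agree_to_order n f (\<lambda>\<epsilon>. (g \<epsilon>)\<^sup>2)" "n > 0" "(g \<longlongrightarrow> c) (at 0)" "Re c > 0"
  shows "agree_to_order n (\<lambda>\<epsilon>. csqrt (f \<epsilon>)) g"
proof -
  have "c\<^sup>2 \<notin> \<real>\<^sub>\<le>\<^sub>0"
    using assms(4) by (auto simp: complex_nonpos_Reals_iff power2_eq_square mult_le_0_iff)
  moreover have "csqrt (c\<^sup>2) = c"
    using assms(4) by (simp add: csqrt_square)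
  moreover have "(f \<longlongrightarrow> c\<^sup>2) (at 0)"
    using assms by (intro agree_to_order_tendsto[OF assms(1)] tendsto_intros)
  ultimately have lim: "((\<lambda>\<epsilon>. csqrt (f \<epsilon>)) \<longlongrightarrow> c) (at 0)"
    using isCont_tendsto_compose[OF continuous_at_csqrt] by metis
  have sum: "((\<lambda>\<epsilon>. csqrt (f \<epsilon>) + g \<epsilon>) \<longlongrightarrow> c + c) (at 0)"
    by (intro tendsto_intros lim assms)
  have ne: "c + c \<noteq> 0" using assms(4) by (auto simp: complex_eq_iff)
  have "(\<lambda>\<epsilon>. (f \<epsilon> - (g \<epsilon>)\<^sup>2) * (1 / (csqrt (f \<epsilon>) + g \<epsilon>))) \<in> O[at 0](\<lambda>\<epsilon>. of_real (\<epsilon> ^ n))"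
    using assms(1) unfolding agree_to_order_def
    by (rule mult_bounded_bigo) (rule tendsto_divide[OF tendsto_const sum ne])
  moreover have "eventually (\<lambda>\<epsilon>. (f \<epsilon> - (g \<epsilon>)\<^sup>2) * (1 / (csqrt (f \<epsilon>) + g \<epsilon>)) = csqrt (f \<epsilon>) - g \<epsilon>) (at 0)"
    using tendsto_imp_eventually_ne[OF sum ne]
  proof eventually_elim
    case (elim \<epsilon>)
    have "f \<epsilon> - (g \<epsilon>)\<^sup>2 = (csqrt (f \<epsilon>) - g \<epsilon>) * (csqrt (f \<epsilon>) + g \<epsilon>)"
      by (simp add: algebra_simps flip: power2_eq_square)
    with elim show ?case by simp
  qed
  ultimately show ?thesis
    unfolding agree_to_order_def by (subst (asm) landau_o.big.in_cong)
qed

lemma agree_to_order_lipschitz: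
  fixes \<phi> :: "'a::real_normed_field \<Rightarrow> 'b::real_normed_field"
  assumes "agree_to_order n f (\<lambda>_. c)" and lip: "\<And>x y. norm (\<phi> x - \<phi> y) \<le> norm (x - y)"
  shows "agree_to_order n (\<lambda>\<epsilon>. \<phi> (f \<epsilon>)) (\<lambda>_. \<phi> c)"
proof -
  from assms(1) obtain C where "C > 0"
    "eventually (\<lambda>\<epsilon>. norm (f \<epsilon> - c) \<le> C * norm (of_real (\<epsilon> ^ n) :: 'a)) (at 0)"
    unfolding agree_to_order_def by (elim landau_o.bigE)
  then show ?thesis
    unfolding agree_to_order_def
    by (intro bigoI[of _ C]) (auto elim!: eventually_mono intro: order_trans[OF lip] simp: norm_power)
qed

lemma agree_to_order_cong:
  assumes "agree_to_order n f g" "eventually (\<lambda>\<epsilon>. h \<epsilon> = f \<epsilon>) (at 0)"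
  shows "agree_to_order n h g"
proof -
  from assms(2) have "eventually (\<lambda>\<epsilon>. h \<epsilon> - g \<epsilon> = f \<epsilon> - g \<epsilon>) (at 0)"
    by eventually_elim simp
  with assms(1) show ?thesis
    unfolding agree_to_order_def by (subst landau_o.big.in_cong)
qed

section \<open>Second-order jets\<close>

definition quad :: "complex \<Rightarrow> complex \<Rightarrow> complex \<Rightarrow> real \<Rightarrow> complex" where
  "quad c0 c1 c2 \<epsilon> = c0 + c1 * of_real \<epsilon> + c2 * (of_real \<epsilon>)\<^sup>2"

text \<open>
  Expansions with error \<open>O(\<epsilon>^3)\<close>; the following lemmas are the usual arithmetic of truncated power series.
\<close>

definition jet2 :: "(real \<Rightarrow> complex) \<Rightarrow> complex \<Rightarrow> complex \<Rightarrow> complex \<Rightarrow> bool" where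
  "jet2 f c0 c1 c2 \<longleftrightarrow> agree_to_order 3 f (quad c0 c1 c2)"

lemma quad_tendsto: "(quad c0 c1 c2 \<longlongrightarrow> c0) (at 0)"
proof -
  have "(quad c0 c1 c2 \<longlongrightarrow> quad c0 c1 c2 0) (at 0)"
    unfolding quad_def by (intro tendsto_intros)
  then show ?thesis by (simp add: quad_def)
qed

lemma jet2_tendsto: "jet2 f c0 c1 c2 \<Longrightarrow> (f \<longlongrightarrow> c0) (at 0)"
  unfolding jet2_def using agree_to_order_tendsto[OF _ _ quad_tendsto] zero_less_numeral by blast

lemma jet2_eventually_nonzero:
  "jet2 f c0 c1 c2 \<Longrightarrow> c0 \<noteq> 0 \<Longrightarrow> eventually (\<lambda>\<epsilon>. f \<epsilon> \<noteq> 0) (at 0)"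
  by (rule tendsto_imp_eventually_ne[OF jet2_tendsto])

lemma jet2_add:
  assumes "jet2 f a0 a1 a2" "jet2 g b0 b1 b2"
  shows "jet2 (\<lambda>\<epsilon>. f \<epsilon> + g \<epsilon>) (a0 + b0) (a1 + b1) (a2 + b2)"
proof -
  have "(\<lambda>\<epsilon>. quad a0 a1 a2 \<epsilon> + quad b0 b1 b2 \<epsilon>) = quad (a0 + b0) (a1 + b1) (a2 + b2)"
    by (rule ext) (simp add: quad_def algebra_simps)
  with agree_to_order_add[OF assms[unfolded jet2_def]] show ?thesis
    by (simp add: jet2_def)
qed

lemma jet2_diff:
  assumes "jet2 f a0 a1 a2" "jet2 g b0 b1 b2"
  shows "jet2 (\<lambda>\<epsilon>. f \<epsilon> - g \<epsilon>) (a0 - b0) (a1 - b1) (a2 - b2)"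
proof -
  have "(\<lambda>\<epsilon>. quad a0 a1 a2 \<epsilon> - quad b0 b1 b2 \<epsilon>) = quad (a0 - b0) (a1 - b1) (a2 - b2)"
    by (rule ext) (simp add: quad_def algebra_simps)
  with agree_to_order_diff[OF assms[unfolded jet2_def]] show ?thesis
    by (simp add: jet2_def)
qed

lemma quad_mult_agree:
  "agree_to_order 3 (\<lambda>\<epsilon>. quad a0 a1 a2 \<epsilon> * quad b0 b1 b2 \<epsilon>)
     (quad (a0 * b0) (a0 * b1 + a1 * b0) (a0 * b2 + a1 * b1 + a2 * b0))"
proof -
  have eq: "quad a0 a1 a2 \<epsilon> * quad b0 b1 b2 \<epsilon> - quad (a0 * b0) (a0 * b1 + a1 * b0) (a0 * b2 + a1 * b1 + a2 * b0) \<epsilon>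
      = of_real (\<epsilon> ^ 3) * quad (a1 * b2 + a2 * b1) (a2 * b2) 0 \<epsilon>" for \<epsilon>
    by (simp add: quad_def algebra_simps power2_eq_square power3_eq_cube)
  show ?thesis
    unfolding agree_to_order_def eq by (rule mult_bounded_bigo[OF _ quad_tendsto]) simp
qed

lemma jet2_mult:
  assumes "jet2 f a0 a1 a2" "jet2 g b0 b1 b2"
  shows "jet2 (\<lambda>\<epsilon>. f \<epsilon> * g \<epsilon>) (a0 * b0) (a0 * b1 + a1 * b0) (a0 * b2 + a1 * b1 + a2 * b0)"
  unfolding jet2_def
  by (rule agree_to_order_trans[OF agree_to_order_mult[OF assms[unfolded jet2_def] _ quad_tendsto quad_tendsto] quad_mult_agree])
    simp

text \<open>
  The coefficients \<open>c0\<close>, \<open>c1\<close>, \<open>c2\<close> of the quotient are given in advance, so that applying the rule leaves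
  equations without division, the coefficients of a product.
\<close>

lemma jet2_divide:
  assumes "jet2 f (c0 * b0) (c0 * b1 + c1 * b0) (c0 * b2 + c1 * b1 + c2 * b0)" "jet2 g b0 b1 b2" "b0 \<noteq> 0"
  shows "jet2 (\<lambda>\<epsilon>. f \<epsilon> / g \<epsilon>) c0 c1 c2"
proof -
  have "agree_to_order 3 f (\<lambda>\<epsilon>. quad c0 c1 c2 \<epsilon> * quad b0 b1 b2 \<epsilon>)"
    using agree_to_order_trans[OF assms(1)[unfolded jet2_def] agree_to_order_sym[OF quad_mult_agree]] .
  then have "agree_to_order 3 (\<lambda>\<epsilon>. f \<epsilon> / g \<epsilon>) (\<lambda>\<epsilon>. quad c0 c1 c2 \<epsilon> * quad b0 b1 b2 \<epsilon> / quad b0 b1 b2 \<epsilon>)"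
    by (rule agree_to_order_divide[OF _ assms(2)[unfolded jet2_def] _
          tendsto_mult[OF quad_tendsto quad_tendsto] quad_tendsto assms(3)]) simp
  moreover have "eventually (\<lambda>\<epsilon>. quad c0 c1 c2 \<epsilon> * quad b0 b1 b2 \<epsilon> / quad b0 b1 b2 \<epsilon> = quad c0 c1 c2 \<epsilon>) (at 0)"
    using tendsto_imp_eventually_ne[OF quad_tendsto[of b0 b1 b2] assms(3)] by eventually_elim simp
  then have "agree_to_order 3 (\<lambda>\<epsilon>. quad c0 c1 c2 \<epsilon> * quad b0 b1 b2 \<epsilon> / quad b0 b1 b2 \<epsilon>) (quad c0 c1 c2)"
    unfolding agree_to_order_def
    by (subst landau_o.big.in_cong[where g = "\<lambda>_. 0"]) (auto elim!: eventually_mono)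
  ultimately show ?thesis
    unfolding jet2_def by (rule agree_to_order_trans)
qed

lemma jet2_csqrt:
  assumes "jet2 f (c0 * c0) (c0 * c1 + c1 * c0) (c0 * c2 + c1 * c1 + c2 * c0)" "Re c0 > 0"
  shows "jet2 (\<lambda>\<epsilon>. csqrt (f \<epsilon>)) c0 c1 c2"
proof -
  have "agree_to_order 3 f (\<lambda>\<epsilon>. (quad c0 c1 c2 \<epsilon>)\<^sup>2)"
    using agree_to_order_trans[OF assms(1)[unfolded jet2_def] agree_to_order_sym[OF quad_mult_agree]]
    by (simp only: power2_eq_square)
  then show ?thesis
    unfolding jet2_def by (rule agree_to_order_csqrt[OF _ _ quad_tendsto assms(2)]) simp
qed

lemma jet2_imp_agree_2:
  assumes "jet2 f c0 0 c2"
  shows "agree_to_order 2 f (\<lambda>_. c0)"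
proof -
  have "(\<lambda>\<epsilon>. of_real (\<epsilon> ^ 3) :: complex) \<in> O[at 0](\<lambda>\<epsilon>. of_real (\<epsilon> ^ 2))"
  proof (rule bigoI)
    show "eventually (\<lambda>\<epsilon>::real. cmod (of_real (\<epsilon> ^ 3)) \<le> 1 * cmod (of_real (\<epsilon> ^ 2))) (at 0)"
      unfolding eventually_at
      by (rule exI[of _ 1]) (use power_decreasing[of 2 3 "\<bar>x\<bar>" for x :: real] in \<open>auto simp: norm_power\<close>)
  qed
  then have "(\<lambda>\<epsilon>. f \<epsilon> - quad c0 0 c2 \<epsilon>) \<in> O[at 0](\<lambda>\<epsilon>. of_real (\<epsilon> ^ 2))"
    using assms landau_o.big_trans unfolding jet2_def agree_to_order_def by blast
  moreover have "(\<lambda>\<epsilon>. c2 * of_real (\<epsilon> ^ 2)) \<in> O[at 0](\<lambda>\<epsilon>. of_real (\<epsilon> ^ 2))"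
    by simp
  ultimately have "(\<lambda>\<epsilon>. (f \<epsilon> - quad c0 0 c2 \<epsilon>) + c2 * of_real (\<epsilon> ^ 2)) \<in> O[at 0](\<lambda>\<epsilon>. of_real (\<epsilon> ^ 2))"
    by (rule sum_in_bigo(1))
  then show ?thesis by (simp add: agree_to_order_def quad_def algebra_simps)
qed

text \<open>
  For an expansion without constant and quadratic term, dividing by \<open>\<epsilon>\<close> loses one order of the error
  and still leaves \<open>O(\<epsilon>^2)\<close>.
\<close>

lemma jet2_divide_parameter:
  assumes "jet2 f 0 c1 0"
  shows "agree_to_order 2 (\<lambda>\<epsilon>. f \<epsilon> / of_real \<epsilon>) (\<lambda>_. c1)"
proof -
  have nz: "eventually (\<lambda>\<epsilon>::real. \<epsilon> \<noteq> 0) (at 0)"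
    by (simp add: eventually_at_filter)
  have "(\<lambda>\<epsilon>. (f \<epsilon> - c1 * of_real \<epsilon>) / of_real \<epsilon>) \<in> O[at 0](\<lambda>\<epsilon>. of_real (\<epsilon> ^ 3) / of_real \<epsilon>)"
    using assms nz unfolding jet2_def agree_to_order_def quad_def by (intro landau_o.big.divide_right) auto
  also have "(\<lambda>\<epsilon>. of_real (\<epsilon> ^ 3) / of_real \<epsilon> :: complex) \<in> O[at 0](\<lambda>\<epsilon>. of_real (\<epsilon> ^ 2))"
    by (subst landau_o.big.in_cong[where g = "\<lambda>\<epsilon>. of_real (\<epsilon> ^ 2)"])
      (auto simp: eventually_at_filter power2_eq_square power3_eq_cube)
  finally have "(\<lambda>\<epsilon>. (f \<epsilon> - c1 * of_real \<epsilon>) / of_real \<epsilon>) \<in> O[at 0](\<lambda>\<epsilon>. of_real (\<epsilon> ^ 2))" .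
  moreover have "eventually (\<lambda>\<epsilon>. (f \<epsilon> - c1 * of_real \<epsilon>) / of_real \<epsilon> = f \<epsilon> / of_real \<epsilon> - c1) (at 0)"
    using nz by eventually_elim (simp add: field_simps)
  ultimately show ?thesis
    unfolding agree_to_order_def by (subst (asm) landau_o.big.in_cong)
qed

lemma jet2_eq:
  assumes "jet2 f a0 a1 a2" "a0 = b0" "a1 = b1" "a2 = b2"
  shows "jet2 f b0 b1 b2"
  using assms by simp

lemma jet2_const: "jet2 (\<lambda>_. c) c 0 0"
proof -
  have "quad c 0 0 = (\<lambda>_. c)" by (rule ext) (simp add: quad_def)
  then show ?thesis by (simp add: jet2_def)
qed

text \<open>
  A quotient whose first two coefficients are known in advance, with the third one determined by them.
\<close>

lemma jet2_divide_1:
  assumes "jet2 f a0 a1 a2" "jet2 g b0 b1 b2" "b0 \<noteq> 0" "c0 * b0 = a0" "c0 * b1 + c1 * b0 = a1"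
  shows "\<exists>c2. jet2 (\<lambda>\<epsilon>. f \<epsilon> / g \<epsilon>) c0 c1 c2"
proof (rule exI, rule jet2_divide[OF jet2_eq[OF assms(1)] assms(2,3)])
  show "a2 = c0 * b2 + c1 * b1 + ((a2 - c0 * b2 - c1 * b1) / b0) * b0"
    using assms(3) by simp
qed (use assms in simp_all)

section \<open>Taylor expansion of the samples\<close>

text \<open>
  By induction: the derivative of the remainder of \<open>s\<close> is the
  remainder of \<open>s'\<close>, and the mean value inequality gains one power of \<open>t\<close>. The bound is kept uniform
  on an interval containing \<open>t = 0\<close>, as the mean value inequality requires.
\<close>

lemma class_C_taylor:
  assumes "class_C n s"
  shows "\<exists>C \<delta>. \<delta> > 0 \<and> (\<forall>t. \<bar>t\<bar> < \<delta> \<longrightarrow>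
    cmod (s (u + t) - (\<Sum>i<n. (velocity ^^ i) s u * of_real (t ^ i / fact i))) \<le> C * \<bar>t\<bar> ^ n)"
  using assms
proof (induction n arbitrary: s)
  case 0
  then have "isCont s u" by (simp add: continuous_on_eq_continuous_at)
  then obtain d where d: "d > 0" "\<And>x. dist x u < d \<Longrightarrow> dist (s x) (s u) < 1"
    unfolding continuous_at_eps_delta by (meson zero_less_one)
  have "cmod (s (u + t)) \<le> cmod (s u) + 1" if "\<bar>t\<bar> < d" for t
  proof -
    have "cmod (s (u + t) - s u) < 1"
      using d(2)[of "u + t"] that by (simp add: dist_norm)
    with norm_triangle_sub[of "s (u + t)" "s u"] show ?thesis by linarith
  qed
  with d(1) show ?case by (intro exI[of _ "cmod (s u) + 1"] exI[of _ d]) simp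
next
  case (Suc n)
  let ?s' = "velocity s"
  from Suc.prems have "class_C n ?s'" by simp
  from Suc.IH[OF this] obtain C \<delta> where \<delta>: "\<delta> > 0" and IH: "\<And>t. \<bar>t\<bar> < \<delta> \<Longrightarrow>
    cmod (?s' (u + t) - (\<Sum>i<n. (velocity ^^ i) ?s' u * of_real (t ^ i / fact i))) \<le> C * \<bar>t\<bar> ^ n"
    by auto
  have C: "C \<ge> 0"
  proof -
    have "0 \<le> C * \<bar>\<delta> / 2\<bar> ^ n"
      by (rule order_trans[OF norm_ge_zero IH]) (use \<delta> in simp)
    moreover have "\<bar>\<delta> / 2\<bar> ^ n > 0" using \<delta> by simp
    ultimately show ?thesis by (metis mult_zero_left mult_le_cancel_right_pos)
  qed
  define R where "R t = s (u + t) - (\<Sum>i<Suc n. (velocity ^^ i) s u * of_real (t ^ i / fact i))" for t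
  define R' where "R' t = ?s' (u + t) - (\<Sum>i<n. (velocity ^^ i) ?s' u * of_real (t ^ i / fact i))" for t
  have deriv: "(R has_vector_derivative R' t) (at t)" for t
  proof -
    have "(s has_vector_derivative ?s' (u + t)) (at (u + t))"
      using Suc.prems by (simp add: vector_derivative_works)
    moreover have shift: "((\<lambda>t. u + t) has_vector_derivative 0 + 1) (at t)"
      by (intro has_vector_derivative_add has_vector_derivative_const has_vector_derivative_id)
    ultimately have "((\<lambda>t. s (u + t)) has_vector_derivative ?s' (u + t)) (at t)"
      using vector_diff_chain_at[OF shift, of s "?s' (u + t)"] by (simp add: o_def)
    moreover have "((\<lambda>t. \<Sum>i<n. (velocity ^^ Suc i) s u * of_real (t ^ Suc i / fact (Suc i)))
      has_vector_derivative (\<Sum>i<n. (velocity ^^ Suc i) s u * of_real (t ^ i / fact i))) (at t)"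
    proof (intro has_vector_derivative_sum has_vector_derivative_mult_right has_vector_derivative_of_real)
      fix i
      show "((\<lambda>t. t ^ Suc i / fact (Suc i)) has_real_derivative t ^ i / fact i) (at t)"
        using DERIV_cdivide[OF DERIV_pow[of "Suc i" t UNIV], of "fact (Suc i)"]
        by (simp del: power_Suc)
    qed
    ultimately have "((\<lambda>t. s (u + t) - (s u + (\<Sum>i<n. (velocity ^^ Suc i) s u * of_real (t ^ Suc i / fact (Suc i)))))
      has_vector_derivative ?s' (u + t) - (0 + (\<Sum>i<n. (velocity ^^ Suc i) s u * of_real (t ^ i / fact i)))) (at t)"
      by (intro has_vector_derivative_diff has_vector_derivative_add has_vector_derivative_const)
    then show ?thesis
      unfolding R_def R'_def sum.lessThan_Suc_shift by (simp add: funpow_Suc_right del: funpow.simps fact_Suc power_Suc)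
  qed
  have "cmod (R t) \<le> C * \<bar>t\<bar> ^ Suc n" if t: "\<bar>t\<bar> < \<delta>" for t
  proof -
    have "norm (R t - R 0) \<le> (C * \<bar>t\<bar> ^ n) * norm (t - 0)"
    proof (rule differentiable_bound[of "{- \<bar>t\<bar>..\<bar>t\<bar>}"])
      fix x assume x: "x \<in> {- \<bar>t\<bar>..\<bar>t\<bar>}"
      show "(R has_derivative (\<lambda>h. h *\<^sub>R R' x)) (at x within {- \<bar>t\<bar>..\<bar>t\<bar>})"
        using deriv[of x] by (simp add: has_vector_derivative_def has_derivative_at_withinI)
      have "onorm (\<lambda>h::real. h *\<^sub>R R' x) = cmod (R' x)"
        using onorm_scaleR_left[OF bounded_linear_ident, of "R' x"] onorm_id[where 'a=real]
        by (simp add: id_def)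
      also have "\<dots> \<le> C * \<bar>x\<bar> ^ n"
      proof -
        have "\<bar>x\<bar> \<le> \<bar>t\<bar>" using x by auto
        with t have "\<bar>x\<bar> < \<delta>" by linarith
        from IH[OF this] show ?thesis unfolding R'_def .
      qed
      also have "\<dots> \<le> C * \<bar>t\<bar> ^ n"
        using x C by (intro mult_left_mono power_mono) auto
      finally show "onorm (\<lambda>h::real. h *\<^sub>R R' x) \<le> C * \<bar>t\<bar> ^ n" .
    qed auto
    moreover have "R 0 = 0"
      unfolding R_def sum.lessThan_Suc_shift by simp
    ultimately show ?thesis by (simp add: mult_ac)
  qed
  with \<delta> show ?case unfolding R_def by blast
qed

lemma class_C_4_taylor_bigo:
  fixes u :: real
  assumes "class_C 4 s"
  defines "s1 \<equiv> velocity s u" and "s2 \<equiv> velocity (velocity s) u"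
    and "s3 \<equiv> velocity (velocity (velocity s)) u"
  shows "(\<lambda>t. s (u + t) - (s u + s1 * of_real t + s2 / 2 * of_real t ^ 2 + s3 / 6 * of_real t ^ 3))
    \<in> O[at 0](\<lambda>t. of_real (t ^ 4))"
proof -
  from class_C_taylor[OF assms(1), of u] obtain C \<delta> where "\<delta> > 0"
    and *: "\<And>t. \<bar>t\<bar> < \<delta> \<Longrightarrow>
      cmod (s (u + t) - (\<Sum>i<4. (velocity ^^ i) s u * of_real (t ^ i / fact i))) \<le> C * \<bar>t\<bar> ^ 4"
    by auto
  have "(\<Sum>i<4. (velocity ^^ i) s u * of_real (t ^ i / fact i)) =
    s u + s1 * of_real t + s2 / 2 * of_real t ^ 2 + s3 / 6 * of_real t ^ 3" for t
    by (simp add: eval_nat_numeral s1_def s2_def s3_def)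
  with * \<open>\<delta> > 0\<close> show ?thesis
    by (intro bigoI[of _ C]) (auto simp: eventually_at norm_power)
qed

text \<open>
  Dividing by \<open>\<epsilon> s'(u)\<close> normalizes position, direction and scale; it costs one order of the remainder,
  hence the four derivatives.
\<close>

lemma jet2_sample:
  fixes u x :: real
  assumes "class_C 4 s" "velocity s u \<noteq> 0" "x \<noteq> 0"
  shows "jet2 (\<lambda>\<epsilon>. (s (u + x * \<epsilon>) - s u) / (of_real \<epsilon> * velocity s u)) (of_real x)
    (velocity (velocity s) u / (2 * velocity s u) * of_real (x ^ 2))
    (velocity (velocity (velocity s)) u / (6 * velocity s u) * of_real (x ^ 3))"
proof -
  define s1 s2 s3 where "s1 = velocity s u" "s2 = velocity (velocity s) u" "s3 = velocity (velocity (velocity s)) u"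
  define R where "R t = s (u + t) - (s u + s1 * of_real t + s2 / 2 * of_real t ^ 2 + s3 / 6 * of_real t ^ 3)" for t
  have s1: "s1 \<noteq> 0" using assms by (simp add: s1_s2_s3_def)
  have nz: "eventually (\<lambda>\<epsilon>::real. \<epsilon> \<noteq> 0) (at 0)"
    by (simp add: eventually_at_filter)
  have "R \<in> O[at 0](\<lambda>t. of_real (t ^ 4))"
    unfolding R_def s1_s2_s3_def by (rule class_C_4_taylor_bigo[OF assms(1)])
  moreover have "filterlim (\<lambda>\<epsilon>. x * \<epsilon>) (at 0) (at 0)"
    using assms(3) nz by (auto simp: filterlim_at intro!: tendsto_eq_intros)
  ultimately have "(\<lambda>\<epsilon>. R (x * \<epsilon>)) \<in> O[at 0](\<lambda>\<epsilon>. of_real ((x * \<epsilon>) ^ 4))"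
    by (rule landau_o.big.compose)
  then have "(\<lambda>\<epsilon>. R (x * \<epsilon>)) \<in> O[at 0](\<lambda>\<epsilon>. of_real (\<epsilon> ^ 4))"
    using assms(3) by (simp add: power_mult_distrib)
  then have "(\<lambda>\<epsilon>. R (x * \<epsilon>) / (of_real \<epsilon> * s1)) \<in> O[at 0](\<lambda>\<epsilon>. of_real (\<epsilon> ^ 4) / (of_real \<epsilon> * s1))"
    using nz s1 by (intro landau_o.big.divide_right) (auto elim!: eventually_mono)
  also have "(\<lambda>\<epsilon>. of_real (\<epsilon> ^ 4) / (of_real \<epsilon> * s1)) \<in> O[at 0](\<lambda>\<epsilon>. of_real (\<epsilon> ^ 3) * (1 / s1))"
    by (subst landau_o.big.in_cong[where g = "\<lambda>\<epsilon>. of_real (\<epsilon> ^ 3) * (1 / s1)"])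
      (auto simp: eventually_at_filter eval_nat_numeral)
  also have "(\<lambda>\<epsilon>. of_real (\<epsilon> ^ 3) * (1 / s1)) \<in> O[at 0](\<lambda>\<epsilon>. of_real (\<epsilon> ^ 3))"
    by (rule mult_bounded_bigo[OF _ tendsto_const]) simp
  finally have "(\<lambda>\<epsilon>. R (x * \<epsilon>) / (of_real \<epsilon> * s1)) \<in> O[at 0](\<lambda>\<epsilon>. of_real (\<epsilon> ^ 3))" .
  moreover have "eventually (\<lambda>\<epsilon>. R (x * \<epsilon>) / (of_real \<epsilon> * s1) = (s (u + x * \<epsilon>) - s u) / (of_real \<epsilon> * s1)
      - quad (of_real x) (s2 / (2 * s1) * of_real (x ^ 2)) (s3 / (6 * s1) * of_real (x ^ 3)) \<epsilon>) (at 0)"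
    using nz
  proof eventually_elim
    case (elim \<epsilon>)
    have "s1 * of_real (x * \<epsilon>) + s2 / 2 * of_real (x * \<epsilon>) ^ 2 + s3 / 6 * of_real (x * \<epsilon>) ^ 3
      = (of_real \<epsilon> * s1) * quad (of_real x) (s2 / (2 * s1) * of_real (x ^ 2)) (s3 / (6 * s1) * of_real (x ^ 3)) \<epsilon>"
      using s1 by (simp add: quad_def field_simps power2_eq_square power3_eq_cube)
    then have "R (x * \<epsilon>) = (s (u + x * \<epsilon>) - s u) - (of_real \<epsilon> * s1)
        * quad (of_real x) (s2 / (2 * s1) * of_real (x ^ 2)) (s3 / (6 * s1) * of_real (x ^ 3)) \<epsilon>"
      unfolding R_def by (simp add: algebra_simps)
    then show ?case
      using s1 elim by (simp add: diff_divide_distrib)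
  qed
  ultimately show ?thesis
    unfolding jet2_def agree_to_order_def s1_s2_s3_def[symmetric] by (subst (asm) landau_o.big.in_cong)
qed

section \<open>Four points in nearly symmetric position\<close>

text \<open>
  The coefficients are \<open>x\<close>, \<open>\<alpha> x^2\<close> and \<open>\<beta> x^3\<close> for \<open>x = -3, -1, 1, 3\<close>.
\<close>

locale symmetric_samples =
  fixes a b c d :: "real \<Rightarrow> complex" and \<alpha> \<beta> :: complex
  assumes ja: "jet2 a (-3) (9 * \<alpha>) (-27 * \<beta>)"
    and jb: "jet2 b (-1) \<alpha> (- \<beta>)"
    and jc: "jet2 c 1 \<alpha> \<beta>"
    and jd: "jet2 d 3 (9 * \<alpha>) (27 * \<beta>)"
begin

lemma jet_ba: "jet2 (\<lambda>\<epsilon>. b \<epsilon> - a \<epsilon>) 2 (-8 * \<alpha>) (26 * \<beta>)"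
  by (rule jet2_eq[OF jet2_diff[OF jb ja]]) simp_all

lemma jet_ca: "jet2 (\<lambda>\<epsilon>. c \<epsilon> - a \<epsilon>) 4 (-8 * \<alpha>) (28 * \<beta>)"
  by (rule jet2_eq[OF jet2_diff[OF jc ja]]) simp_all

lemma jet_da: "jet2 (\<lambda>\<epsilon>. d \<epsilon> - a \<epsilon>) 6 0 (54 * \<beta>)"
  by (rule jet2_eq[OF jet2_diff[OF jd ja]]) simp_all

lemma jet_cb: "jet2 (\<lambda>\<epsilon>. c \<epsilon> - b \<epsilon>) 2 0 (2 * \<beta>)"
  by (rule jet2_eq[OF jet2_diff[OF jc jb]]) simp_all

lemma jet_db: "jet2 (\<lambda>\<epsilon>. d \<epsilon> - b \<epsilon>) 4 (8 * \<alpha>) (28 * \<beta>)"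
  by (rule jet2_eq[OF jet2_diff[OF jd jb]]) simp_all

lemma jet_dc: "jet2 (\<lambda>\<epsilon>. d \<epsilon> - c \<epsilon>) 2 (8 * \<alpha>) (26 * \<beta>)"
  by (rule jet2_eq[OF jet2_diff[OF jd jc]]) simp_all

lemma jet_bd: "jet2 (\<lambda>\<epsilon>. b \<epsilon> - d \<epsilon>) (-4) (-8 * \<alpha>) (-28 * \<beta>)"
  by (rule jet2_eq[OF jet2_diff[OF jb jd]]) simp_all

lemma jet_ab: "jet2 (\<lambda>\<epsilon>. a \<epsilon> - b \<epsilon>) (-2) (8 * \<alpha>) (-26 * \<beta>)"
  by (rule jet2_eq[OF jet2_diff[OF ja jb]]) simp_all

lemma jet_bc: "jet2 (\<lambda>\<epsilon>. b \<epsilon> - c \<epsilon>) (-2) 0 (-2 * \<beta>)"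
  by (rule jet2_eq[OF jet2_diff[OF jb jc]]) simp_all

lemma jet_ad: "jet2 (\<lambda>\<epsilon>. a \<epsilon> - d \<epsilon>) (-6) 0 (-54 * \<beta>)"
  by (rule jet2_eq[OF jet2_diff[OF ja jd]]) simp_all

lemma eventually_distinct:
  "eventually (\<lambda>\<epsilon>. a \<epsilon> \<noteq> b \<epsilon> \<and> a \<epsilon> \<noteq> c \<epsilon> \<and> a \<epsilon> \<noteq> d \<epsilon> \<and> b \<epsilon> \<noteq> c \<epsilon> \<and> b \<epsilon> \<noteq> d \<epsilon> \<and> c \<epsilon> \<noteq> d \<epsilon>) (at 0)"
  using jet_ba[THEN jet2_eventually_nonzero, simplified] jet_ca[THEN jet2_eventually_nonzero, simplified]
    jet_da[THEN jet2_eventually_nonzero, simplified] jet_cb[THEN jet2_eventually_nonzero, simplified]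
    jet_db[THEN jet2_eventually_nonzero, simplified] jet_dc[THEN jet2_eventually_nonzero, simplified]
  by eventually_elim auto

definition "q \<epsilon> = csqrt (cross_ratio (c \<epsilon>) (a \<epsilon>) (b \<epsilon>) (d \<epsilon>))"
definition "r \<epsilon> = csqrt (cross_ratio (d \<epsilon>) (b \<epsilon>) (c \<epsilon>) (a \<epsilon>))"

text \<open>
  The linear term vanishes: up to \<open>O(\<epsilon>^2)\<close> the map \<open>x \<mapsto> x + \<alpha> x^2 \<epsilon>\<close> is the Moebius
  transformation \<open>x / (1 - \<alpha> \<epsilon> x)\<close>, which preserves cross-ratios.
\<close>

lemma jet_q: "jet2 q 2 0 (12 * (\<alpha>\<^sup>2 - \<beta>))"
proof -
  have "jet2 (\<lambda>\<epsilon>. cross_ratio (c \<epsilon>) (a \<epsilon>) (b \<epsilon>) (d \<epsilon>)) 4 0 (48 * (\<alpha>\<^sup>2 - \<beta>))"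
    unfolding cross_ratio_def
    by (rule jet2_divide[OF jet2_eq[OF jet2_mult[OF jet_ca jet_bd]] jet2_mult[OF jet_ab jet_dc]])
      (simp_all add: algebra_simps power2_eq_square)
  then show ?thesis
    unfolding q_def by (intro jet2_csqrt) (rule jet2_eq, simp_all)
qed

definition \<sigma> :: complex where "\<sigma> = of_real (sqrt 3)"

lemma \<sigma>_sq: "\<sigma> * \<sigma> = 3" and \<sigma>_nz: "\<sigma> \<noteq> 0" and Re_\<sigma>: "Re \<sigma> > 0"
  unfolding \<sigma>_def by (simp_all flip: of_real_mult)

lemma \<sigma>_sq': "\<sigma> * (\<sigma> * x) = 3 * x"
  by (simp add: \<sigma>_sq flip: mult.assoc)

lemma jet_r: "jet2 r (2 / 3 * \<sigma>) 0 (4 / 3 * \<sigma> * (\<beta> - \<alpha>\<^sup>2))"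
proof -
  have j: "jet2 (\<lambda>\<epsilon>. cross_ratio (d \<epsilon>) (b \<epsilon>) (c \<epsilon>) (a \<epsilon>)) (4 / 3) 0 (16 / 3 * (\<beta> - \<alpha>\<^sup>2))"
    unfolding cross_ratio_def
    by (rule jet2_divide[OF jet2_eq[OF jet2_mult[OF jet_db jet_ca]] jet2_mult[OF jet_bc jet_ad]])
      (simp_all add: field_simps power2_eq_square)
  have "4 / 3 = 2 / 3 * \<sigma> * (2 / 3 * \<sigma>)"
    "16 / 3 * (\<beta> - \<alpha>\<^sup>2) = 2 / 3 * \<sigma> * (4 / 3 * \<sigma> * (\<beta> - \<alpha>\<^sup>2)) + 0 * 0 + 4 / 3 * \<sigma> * (\<beta> - \<alpha>\<^sup>2) * (2 / 3 * \<sigma>)"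
    by (simp_all add: field_simps \<sigma>_sq \<sigma>_sq')
  with Re_\<sigma> show ?thesis
    unfolding r_def by (intro jet2_csqrt jet2_eq[OF j]) simp_all
qed

text \<open>
  The values \<open>f(a,b,c,d)\<close>, \<open>f(b,c,d,a)\<close> and \<open>f(d,a,b,c)\<close> with their denominators, and the midpoint and
  half difference of the inverted points. Defined by \<open>b\<close> and \<open>c\<close>, \<open>\<tau>\<close> inherits its accuracy \<open>O(\<epsilon>^3)\<close> from \<open>p\<close>
  alone, while \<open>\<eta>\<close> is only known, and only has to be known, up to \<open>O(\<epsilon>^2)\<close>.
\<close>

definition "Dp \<epsilon> = (b \<epsilon> - a \<epsilon>) * q \<epsilon> + (c \<epsilon> - a \<epsilon>)"
definition "Dv \<epsilon> = (c \<epsilon> - b \<epsilon>) * r \<epsilon> + (d \<epsilon> - b \<epsilon>)"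
definition "Dw \<epsilon> = (a \<epsilon> - d \<epsilon>) * r \<epsilon> + (b \<epsilon> - d \<epsilon>)"
definition "p \<epsilon> = (c \<epsilon> * (b \<epsilon> - a \<epsilon>) * q \<epsilon> + b \<epsilon> * (c \<epsilon> - a \<epsilon>)) / Dp \<epsilon>"
definition "v \<epsilon> = (d \<epsilon> * (c \<epsilon> - b \<epsilon>) * r \<epsilon> + c \<epsilon> * (d \<epsilon> - b \<epsilon>)) / Dv \<epsilon>"
definition "w \<epsilon> = (b \<epsilon> * (a \<epsilon> - d \<epsilon>) * r \<epsilon> + a \<epsilon> * (b \<epsilon> - d \<epsilon>)) / Dw \<epsilon>"
definition "\<tau> \<epsilon> = (1 / (b \<epsilon> - p \<epsilon>) + 1 / (c \<epsilon> - p \<epsilon>)) / 2"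
definition "\<eta> \<epsilon> = (1 / (v \<epsilon> - p \<epsilon>) - 1 / (w \<epsilon> - p \<epsilon>)) / 2"

lemma jet_Dp: "jet2 Dp 8 (-24 * \<alpha>) (52 * \<beta> + 24 * (\<alpha>\<^sup>2 - \<beta>) + 28 * \<beta>)"
  unfolding Dp_def
  by (rule jet2_eq[OF jet2_add[OF jet2_mult[OF jet_ba jet_q] jet_ca]]) (simp_all add: algebra_simps)

lemma jet_Dv: "\<exists>c2. jet2 Dv (4 / 3 * \<sigma> + 4) (8 * \<alpha>) c2"
  unfolding Dv_def
  by (rule exI, rule jet2_eq[OF jet2_add[OF jet2_mult[OF jet_cb jet_r] jet_db]]) simp_all

lemma jet_Dw: "\<exists>c2. jet2 Dw (- 4 * \<sigma> - 4) (-8 * \<alpha>) c2"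
  unfolding Dw_def
  by (rule exI, rule jet2_eq[OF jet2_add[OF jet2_mult[OF jet_ad jet_r] jet_bd]]) simp_all

lemma Dv_Dw_limits_nz: "4 / 3 * \<sigma> + 4 \<noteq> 0" "- 4 * \<sigma> - 4 \<noteq> 0"
  using Re_\<sigma> by (auto simp: complex_eq_iff)

text \<open>
  All three coefficients of the numerator cancel. The constant and linear ones do so by the Moebius
  invariance of \<open>f\<close>, which maps \<open>(-3, -1, 1, 3)\<close> to \<open>0\<close>; the quadratic one because replacing \<open>\<epsilon>\<close> by \<open>- \<epsilon>\<close>
  turns \<open>(a, b, c, d)\<close> into \<open>(- d, - c, - b, - a)\<close> up to \<open>O(\<epsilon>^3)\<close>, and \<open>p\<close> into \<open>- p\<close>.
\<close>

lemma jet_p: "jet2 p 0 0 0"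
  unfolding p_def
proof (rule jet2_divide[OF _ jet_Dp])
  show "jet2 (\<lambda>\<epsilon>. c \<epsilon> * (b \<epsilon> - a \<epsilon>) * q \<epsilon> + b \<epsilon> * (c \<epsilon> - a \<epsilon>)) (0 * 8) (0 * (-24 * \<alpha>) + 0 * 8)
     (0 * (52 * \<beta> + 24 * (\<alpha>\<^sup>2 - \<beta>) + 28 * \<beta>) + 0 * (-24 * \<alpha>) + 0 * 8)"
    by (rule jet2_eq[OF jet2_add[OF jet2_mult[OF jet2_mult[OF jc jet_ba] jet_q] jet2_mult[OF jb jet_ca]]])
      (simp_all add: algebra_simps power2_eq_square)
qed simp

lemma jet_v: "\<exists>c2. jet2 v \<sigma> (3 * \<alpha>) c2"
proof -
  from jet_Dv obtain c2 where "jet2 Dv (4 / 3 * \<sigma> + 4) (8 * \<alpha>) c2" ..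
  then show ?thesis
    unfolding v_def
    by (rule jet2_divide_1[OF jet2_add[OF jet2_mult[OF jet2_mult[OF jd jet_cb] jet_r] jet2_mult[OF jc jet_db]] _ Dv_Dw_limits_nz(1)])
      (simp_all add: algebra_simps \<sigma>_sq \<sigma>_sq')
qed

lemma jet_w: "\<exists>c2. jet2 w (- \<sigma>) (3 * \<alpha>) c2"
proof -
  from jet_Dw obtain c2 where "jet2 Dw (- 4 * \<sigma> - 4) (-8 * \<alpha>) c2" ..
  then show ?thesis
    unfolding w_def
    by (rule jet2_divide_1[OF jet2_add[OF jet2_mult[OF jet2_mult[OF jb jet_ad] jet_r] jet2_mult[OF ja jet_bd]] _ Dv_Dw_limits_nz(2)])
      (simp_all add: algebra_simps \<sigma>_sq \<sigma>_sq')
qed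

text \<open>
  In the limit, \<open>1 / \<tau>\<close> is the image of infinity under \<open>x \<mapsto> x / (1 - \<alpha> \<epsilon> x)\<close>, that is,
  \<open>- 1 / (\<alpha> \<epsilon>)\<close>; there is no error of order \<open>\<epsilon>^2\<close> because those of \<open>1 / (b - p)\<close> and
  \<open>1 / (c - p)\<close> are opposite.
\<close>

lemma jet_\<tau>: "jet2 \<tau> 0 (- \<alpha>) 0"
proof -
  have "jet2 (\<lambda>\<epsilon>. b \<epsilon> - p \<epsilon>) (-1) \<alpha> (- \<beta>)" "jet2 (\<lambda>\<epsilon>. c \<epsilon> - p \<epsilon>) 1 \<alpha> \<beta>"
    using jet2_diff[OF jb jet_p] jet2_diff[OF jc jet_p] by simp_all
  then have "jet2 (\<lambda>\<epsilon>. 1 / (b \<epsilon> - p \<epsilon>)) (-1) (- \<alpha>) (\<beta> - \<alpha>\<^sup>2)" "jet2 (\<lambda>\<epsilon>. 1 / (c \<epsilon> - p \<epsilon>)) 1 (- \<alpha>) (\<alpha>\<^sup>2 - \<beta>)"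
    by (auto intro!: jet2_divide[rotated] jet2_eq[OF jet2_const] simp: power2_eq_square)
  from jet2_add[OF this] show ?thesis
    unfolding \<tau>_def by (intro jet2_divide[OF _ jet2_const]) (rule jet2_eq, simp_all add: mult.commute)
qed

text \<open>
  The linear terms of \<open>1 / (v - p)\<close> and \<open>1 / (w - p)\<close> are both \<open>- \<alpha>\<close> and cancel in the difference.
\<close>

lemma jet_\<eta>: "\<exists>c2. jet2 \<eta> (1 / \<sigma>) 0 c2"
proof -
  from jet_v jet_w obtain v2 w2 where "jet2 v \<sigma> (3 * \<alpha>) v2" "jet2 w (- \<sigma>) (3 * \<alpha>) w2" by blast
  from this[THEN jet2_diff[OF _ jet_p]]
  have vp: "jet2 (\<lambda>\<epsilon>. v \<epsilon> - p \<epsilon>) \<sigma> (3 * \<alpha>) v2" and wp: "jet2 (\<lambda>\<epsilon>. w \<epsilon> - p \<epsilon>) (- \<sigma>) (3 * \<alpha>) w2"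
    by simp_all
  have 3: "3 / \<sigma> = \<sigma>" using \<sigma>_sq \<sigma>_nz by (simp add: divide_eq_eq)
  have "\<exists>c2. jet2 (\<lambda>\<epsilon>. 1 / (v \<epsilon> - p \<epsilon>)) (1 / \<sigma>) (- \<alpha>) c2"
    by (rule jet2_divide_1[OF jet2_const vp \<sigma>_nz]) (use \<sigma>_nz 3 in \<open>simp_all add: algebra_simps\<close>)
  moreover have "\<exists>c2. jet2 (\<lambda>\<epsilon>. 1 / (w \<epsilon> - p \<epsilon>)) (- 1 / \<sigma>) (- \<alpha>) c2"
    by (rule jet2_divide_1[OF jet2_const wp]) (use \<sigma>_nz 3 in \<open>simp_all add: algebra_simps\<close>)
  ultimately obtain v3 w3 where "jet2 (\<lambda>\<epsilon>. 1 / (v \<epsilon> - p \<epsilon>)) (1 / \<sigma>) (- \<alpha>) v3"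
    "jet2 (\<lambda>\<epsilon>. 1 / (w \<epsilon> - p \<epsilon>)) (- 1 / \<sigma>) (- \<alpha>) w3" by blast
  from jet2_diff[OF this] show ?thesis
    unfolding \<eta>_def by (rule jet2_divide_1[OF _ jet2_const]) simp_all
qed

text \<open>
  Near \<open>\<epsilon> = 0\<close> all nondegeneracy conditions of the exact identities hold, since the denominators and
  differences have nonzero limits.
\<close>

lemma eventually_f_pt:
  "eventually (\<lambda>\<epsilon>.
     f_pt (a \<epsilon>) (b \<epsilon>) (c \<epsilon>) (d \<epsilon>) = Some (p \<epsilon>) \<and>
     f_pt (b \<epsilon>) (c \<epsilon>) (d \<epsilon>) (a \<epsilon>) = Some (v \<epsilon>) \<and>
     f_pt (d \<epsilon>) (a \<epsilon>) (b \<epsilon>) (c \<epsilon>) = Some (w \<epsilon>) \<and>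
     f_pt (c \<epsilon>) (d \<epsilon>) (a \<epsilon>) (b \<epsilon>) = (if \<tau> \<epsilon> = 0 then None else Some (p \<epsilon> + 1 / \<tau> \<epsilon>)) \<and>
     v \<epsilon> \<noteq> p \<epsilon> \<and> w \<epsilon> \<noteq> p \<epsilon> \<and> v \<epsilon> \<noteq> w \<epsilon> \<and>
     \<tau> \<epsilon> = (1 / (v \<epsilon> - p \<epsilon>) + 1 / (w \<epsilon> - p \<epsilon>)) / 2) (at 0)"
proof -
  obtain v2 w2 Dv2 Dw2 \<eta>2 where jets: "jet2 v \<sigma> (3 * \<alpha>) v2" "jet2 w (- \<sigma>) (3 * \<alpha>) w2"
    "jet2 Dv (4 / 3 * \<sigma> + 4) (8 * \<alpha>) Dv2" "jet2 Dw (- 4 * \<sigma> - 4) (-8 * \<alpha>) Dw2" "jet2 \<eta> (1 / \<sigma>) 0 \<eta>2"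
    using jet_v jet_w jet_Dv jet_Dw jet_\<eta> by blast
  have "eventually (\<lambda>\<epsilon>. v \<epsilon> - p \<epsilon> \<noteq> 0) (at 0)" "eventually (\<lambda>\<epsilon>. w \<epsilon> - p \<epsilon> \<noteq> 0) (at 0)"
    using jets(1,2)[THEN jet2_diff[OF _ jet_p], THEN jet2_eventually_nonzero] \<sigma>_nz by simp_all
  moreover have "eventually (\<lambda>\<epsilon>. Dp \<epsilon> \<noteq> 0) (at 0)" "eventually (\<lambda>\<epsilon>. Dv \<epsilon> \<noteq> 0) (at 0)"
    "eventually (\<lambda>\<epsilon>. Dw \<epsilon> \<noteq> 0) (at 0)" "eventually (\<lambda>\<epsilon>. \<eta> \<epsilon> \<noteq> 0) (at 0)"
    using jet_Dp[THEN jet2_eventually_nonzero] jets(3-)[THEN jet2_eventually_nonzero] Dv_Dw_limits_nz \<sigma>_nz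
    by simp_all
  ultimately show ?thesis
    using eventually_distinct
  proof eventually_elim
    case (elim \<epsilon>)
    then have distinct: "a \<epsilon> \<noteq> b \<epsilon>" "a \<epsilon> \<noteq> c \<epsilon>" "a \<epsilon> \<noteq> d \<epsilon>" "b \<epsilon> \<noteq> c \<epsilon>" "b \<epsilon> \<noteq> d \<epsilon>" "c \<epsilon> \<noteq> d \<epsilon>"
      by auto
    note sqrts = csqrt_cross_ratio_f_pt[OF distinct, folded q_def r_def]
    have p: "f_pt (a \<epsilon>) (b \<epsilon>) (c \<epsilon>) (d \<epsilon>) = Some (p \<epsilon>)"
      using elim(3) unfolding f_pt_def Let_def q_def[symmetric] p_def Dp_def by simp
    have v: "f_pt (b \<epsilon>) (c \<epsilon>) (d \<epsilon>) (a \<epsilon>) = Some (v \<epsilon>)"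
      using elim(4) unfolding f_pt_def Let_def r_def[symmetric] v_def Dv_def by simp
    have w: "f_pt (d \<epsilon>) (a \<epsilon>) (b \<epsilon>) (c \<epsilon>) = Some (w \<epsilon>)"
      using elim(5) unfolding f_pt_def Let_def sqrts(4) w_def Dw_def by simp
    have ne: "v \<epsilon> \<noteq> p \<epsilon>" "w \<epsilon> \<noteq> p \<epsilon>" "v \<epsilon> \<noteq> w \<epsilon>"
      using elim(1,2,6) by (auto simp: \<eta>_def)
    have "1 / (v \<epsilon> - p \<epsilon>) + 1 / (w \<epsilon> - p \<epsilon>) = 1 / (b \<epsilon> - p \<epsilon>) + 1 / (c \<epsilon> - p \<epsilon>)"
      using inverse_midpoints_coincide[OF distinct sqrts(1,2)] elim(3-5) ne(1)
      unfolding p_def v_def w_def Dp_def Dv_def Dw_def by blast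
    then have "\<tau> \<epsilon> = (1 / (v \<epsilon> - p \<epsilon>) + 1 / (w \<epsilon> - p \<epsilon>)) / 2"
      by (simp add: \<tau>_def)
    with p v w ne f_pt_opposite[OF distinct p] show ?case
      unfolding \<tau>_def[symmetric] by blast
  qed
qed

end

section \<open>Asymptotics of the discrete curvature circle\<close>

text \<open>
  Undoing the normalization by the similarity \<open>z \<mapsto> s(u) + l z\<close> with \<open>l = \<epsilon> s'(u)\<close> divides the inverted
  quantities \<open>\<tau>\<close> and \<open>\<eta>\<close> by \<open>l\<close>.
\<close>

lemma eventually_four_point_circle:
  fixes s :: "real \<Rightarrow> complex" and u :: real
  assumes "class_C 4 s" "velocity s u \<noteq> 0"
  defines "\<alpha> \<equiv> velocity (velocity s) u / (2 * velocity s u)"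
  obtains p \<tau> \<eta> \<eta>2 where "jet2 p 0 0 0" "jet2 \<tau> 0 (- \<alpha>) 0" "jet2 \<eta> (1 / of_real (sqrt 3)) 0 \<eta>2"
    "eventually (\<lambda>\<epsilon>. edge_point (sampling s u \<epsilon>) 0 = Some (s u + of_real \<epsilon> * velocity s u * p \<epsilon>) \<and>
      discrete_curvature_circle (sampling s u \<epsilon>) 0 = circle_through (s u + of_real \<epsilon> * velocity s u * p \<epsilon>)
        (Im (\<tau> \<epsilon> * cnj (\<eta> \<epsilon>)) / (\<epsilon> * cmod (velocity s u))\<^sup>2) (\<i> * cnj (\<eta> \<epsilon> / (of_real \<epsilon> * velocity s u)))) (at 0)"
proof -
  define \<beta> where "\<beta> = velocity (velocity (velocity s)) u / (6 * velocity s u)"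
  define z where "z x \<epsilon> = (s (u + x * \<epsilon>) - s u) / (of_real \<epsilon> * velocity s u)" for x \<epsilon>
  have "jet2 (z x) (of_real x) (\<alpha> * of_real (x ^ 2)) (\<beta> * of_real (x ^ 3))" if "x \<noteq> 0" for x
    using jet2_sample[OF assms(1,2) that] by (simp add: z_def[abs_def] \<alpha>_def \<beta>_def)
  from this[of "-3"] this[of "-1"] this[of 1] this[of 3]
  interpret symmetric_samples "z (-3)" "z (-1)" "z 1" "z 3" \<alpha> \<beta>
    by unfold_locales (simp_all add: mult.commute)
  obtain \<eta>2 where j: "jet2 \<eta> (1 / of_real (sqrt 3)) 0 \<eta>2"
    using jet_\<eta> by (auto simp: \<sigma>_def)
  show ?thesis
  proof (rule that[OF jet_p jet_\<tau> j])
    have "eventually (\<lambda>\<epsilon>::real. \<epsilon> \<noteq> 0) (at 0)"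
      by (simp add: eventually_at_filter)
    then show "eventually (\<lambda>\<epsilon>. edge_point (sampling s u \<epsilon>) 0 = Some (s u + of_real \<epsilon> * velocity s u * p \<epsilon>) \<and>
      discrete_curvature_circle (sampling s u \<epsilon>) 0 = circle_through (s u + of_real \<epsilon> * velocity s u * p \<epsilon>)
        (Im (\<tau> \<epsilon> * cnj (\<eta> \<epsilon>)) / (\<epsilon> * cmod (velocity s u))\<^sup>2) (\<i> * cnj (\<eta> \<epsilon> / (of_real \<epsilon> * velocity s u)))) (at 0)"
      using eventually_f_pt
    proof eventually_elim
      case (elim \<epsilon>)
      define l where "l = of_real \<epsilon> * velocity s u"
      have l: "l \<noteq> 0" using elim assms by (simp add: l_def)
      have sample: "s (u + x * \<epsilon>) = s u + l * z x \<epsilon>" for x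
        using l by (simp add: z_def l_def)
      have samples: "sampling s u \<epsilon> (- 1) = s u + l * z (-3) \<epsilon>" "sampling s u \<epsilon> 0 = s u + l * z (-1) \<epsilon>"
        "sampling s u \<epsilon> 1 = s u + l * z 1 \<epsilon>" "sampling s u \<epsilon> 2 = s u + l * z 3 \<epsilon>"
        unfolding sample[symmetric] by (simp_all add: sampling_def)
      let ?P = "s u + l * p \<epsilon>" and ?V = "l * (v \<epsilon> - p \<epsilon>)" and ?W = "l * (w \<epsilon> - p \<epsilon>)"
      have VW: "?V \<noteq> 0" "?W \<noteq> 0" "?V \<noteq> ?W" using l elim by simp_all
      have tau: "(1 / ?V + 1 / ?W) / 2 = \<tau> \<epsilon> / l"
      proof -
        have "(1 / (l * x) + 1 / (l * y)) / 2 = (1 / x + 1 / y) / 2 / l" for x y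
          by (simp add: add_divide_distrib mult_ac)
        moreover have "\<tau> \<epsilon> = (1 / (v \<epsilon> - p \<epsilon>) + 1 / (w \<epsilon> - p \<epsilon>)) / 2"
          using elim by blast
        ultimately show ?thesis by (simp only:)
      qed
      have eta: "(1 / ?V - 1 / ?W) / 2 = \<eta> \<epsilon> / l"
      proof -
        have "(1 / (l * x) - 1 / (l * y)) / 2 = (1 / x - 1 / y) / 2 / l" for x y
          by (simp add: diff_divide_distrib mult_ac)
        then show ?thesis unfolding \<eta>_def .
      qed
      have "four_point_circle (s u + l * z (-3) \<epsilon>) (s u + l * z (-1) \<epsilon>) (s u + l * z 1 \<epsilon>) (s u + l * z 3 \<epsilon>)
        = circle_through ?P (Im ((1 / ?V + 1 / ?W) / 2 * cnj ((1 / ?V - 1 / ?W) / 2))) (\<i> * cnj ((1 / ?V - 1 / ?W) / 2))"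
      proof (rule four_point_circle_eq[OF _ _ _ VW])
        show "f_pt (s u + l * z 1 \<epsilon>) (s u + l * z 3 \<epsilon>) (s u + l * z (-3) \<epsilon>) (s u + l * z (-1) \<epsilon>) =
          (if (1 / ?V + 1 / ?W) / 2 = 0 then None else Some (?P + 1 / ((1 / ?V + 1 / ?W) / 2)))"
          unfolding tau f_pt_affine[OF l] using elim l by (simp add: algebra_simps)
      qed (unfold f_pt_affine[OF l], use elim in \<open>simp_all add: algebra_simps\<close>)
      moreover have "Im (\<tau> \<epsilon> / l * cnj (\<eta> \<epsilon> / l)) = Im (\<tau> \<epsilon> * cnj (\<eta> \<epsilon>)) / (\<epsilon> * cmod (velocity s u))\<^sup>2"
      proof -
        have "\<tau> \<epsilon> / l * cnj (\<eta> \<epsilon> / l) = \<tau> \<epsilon> * cnj (\<eta> \<epsilon>) / (l * cnj l)"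
          by simp
        also have "l * cnj l = of_real ((cmod l)\<^sup>2)"
          by (rule complex_norm_square[symmetric])
        also have "(cmod l)\<^sup>2 = (\<epsilon> * cmod (velocity s u))\<^sup>2"
          by (simp add: l_def norm_mult power_mult_distrib)
        finally show ?thesis
          by (simp only: Im_divide_of_real)
      qed
      moreover have "f_pt (s u + l * z (-3) \<epsilon>) (s u + l * z (-1) \<epsilon>) (s u + l * z 1 \<epsilon>) (s u + l * z 3 \<epsilon>) = Some ?P"
        unfolding f_pt_affine[OF l] using elim by simp
      ultimately show ?case
        unfolding edge_point_def discrete_curvature_circle_def l_def[symmetric] tau eta
        by (simp add: samples)
    qed
  qed
qed

text \<open>
  Curvature and center in terms of \<open>\<tau> / \<epsilon>\<close>, which has a finite limit, while \<open>\<tau>\<close> itself tends to 0.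
\<close>

lemma circle_through_scaled_curvature:
  assumes "\<eta> \<noteq> 0" "l \<noteq> 0" "\<epsilon> \<noteq> (0::real)"
  shows "circle_curvature (circle_through P (Im (\<tau> * cnj \<eta>) / (\<epsilon> * cmod l)\<^sup>2) (\<i> * cnj (\<eta> / (of_real \<epsilon> * l))))
    = 2 * \<bar>Im (\<tau> / of_real \<epsilon> * cnj \<eta>)\<bar> / (cmod l * cmod \<eta>)"
proof -
  have "\<tau> / of_real \<epsilon> * cnj \<eta> = \<tau> * cnj \<eta> / of_real \<epsilon>" by simp
  then have "Im (\<tau> / of_real \<epsilon> * cnj \<eta>) = Im (\<tau> * cnj \<eta>) / \<epsilon>"
    by (simp only: Im_divide_of_real)
  moreover have "2 * \<bar>I / (\<epsilon> * L)\<^sup>2\<bar> / (E / (\<bar>\<epsilon>\<bar> * L)) = 2 * \<bar>I / \<epsilon>\<bar> / (L * E)" if "L > 0" "E > 0" for I L E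
    using that assms(3) by (simp add: abs_mult power2_eq_square divide_simps)
  moreover have "cmod (\<i> * cnj (\<eta> / (of_real \<epsilon> * l))) = cmod \<eta> / (\<bar>\<epsilon>\<bar> * cmod l)"
    by (simp add: norm_mult norm_divide)
  moreover have "\<i> * cnj (\<eta> / (of_real \<epsilon> * l)) \<noteq> 0"
    using assms by simp
  ultimately show ?thesis
    using circle_curvature_circle_through assms by (metis zero_less_norm_iff)
qed

lemma circle_through_scaled_center:
  assumes "\<eta> \<noteq> 0" "l \<noteq> 0" "\<epsilon> \<noteq> (0::real)" "Im (\<tau> / of_real \<epsilon> * cnj \<eta>) \<noteq> 0"
  shows "circle_center (circle_through P (Im (\<tau> * cnj \<eta>) / (\<epsilon> * cmod l)\<^sup>2) (\<i> * cnj (\<eta> / (of_real \<epsilon> * l))))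
    = Some (P - \<i> * l * (cnj \<eta> / of_real (2 * Im (\<tau> / of_real \<epsilon> * cnj \<eta>))))"
proof -
  have "\<tau> / of_real \<epsilon> * cnj \<eta> = \<tau> * cnj \<eta> / of_real \<epsilon>" by simp
  then have I: "Im (\<tau> / of_real \<epsilon> * cnj \<eta>) = Im (\<tau> * cnj \<eta>) / \<epsilon>"
    by (simp only: Im_divide_of_real)
  with assms have ne: "Im (\<tau> * cnj \<eta>) / (\<epsilon> * cmod l)\<^sup>2 \<noteq> 0" "\<i> * cnj (\<eta> / (of_real \<epsilon> * l)) \<noteq> 0"
    by simp_all
  have "\<i> * cnj (\<eta> / (of_real \<epsilon> * l)) / of_real (2 * (J / (\<epsilon> * cmod l)\<^sup>2)) = \<i> * l * (cnj \<eta> / of_real (2 * (J / \<epsilon>)))" for J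
  proof -
    have l2: "of_real (cmod l) ^ 2 = l * cnj l" by (metis complex_norm_square of_real_power)
    have "\<i> * (x / (e * y)) / (2 * (j / (e\<^sup>2 * (l * y)))) = \<i> * l * (x / (2 * (j / e)))" 
      if "e \<noteq> 0" "y \<noteq> 0" for x y e j :: complex
      using that assms(2) by (simp add: power2_eq_square divide_simps)
    from this[of "of_real \<epsilon>" "cnj l" "cnj \<eta>" "of_real J"] assms show ?thesis
      by (simp add: power_mult_distrib l2)
  qed
  then show ?thesis
    unfolding circle_center_circle_through[OF ne] I by (simp only:)
qed

text \<open>
  Both are expressed through \<open>\<alpha> = s'' / (2 s')\<close>, since \<open>det(s', s'') = \<bar>s'\<bar>^2 Im (s'' / s')\<close>.
\<close>

lemma curvature_normal_eq:
  assumes "velocity s u \<noteq> 0"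
  defines "\<alpha> \<equiv> velocity (velocity s) u / (2 * velocity s u)"
  shows "curvature s u = 2 * Im \<alpha> / cmod (velocity s u)"
    and "of_real (1 / curvature s u) * unit_normal s u = \<i> * velocity s u / of_real (2 * Im \<alpha>)"
proof -
  have "det2 x y = (cmod x)\<^sup>2 * Im (y / x)" if "x \<noteq> 0" for x y
    using that unfolding complex_div_cnj[of y x] by (simp add: det2_def Im_divide_of_real flip: of_real_power)
  from this[OF assms(1)] show *: "curvature s u = 2 * Im \<alpha> / cmod (velocity s u)"
  proof -
    have "Im (velocity (velocity s) u / velocity s u) = 2 * Im \<alpha>"
    proof -
      have "velocity (velocity s) u / velocity s u = of_real 2 * \<alpha>"
        using assms(1) by (simp add: \<alpha>_def)
      then show ?thesis by simp
    qed
    with \<open>det2 (velocity s u) (velocity (velocity s) u) = _\<close> show ?thesis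
      using assms(1) by (simp add: curvature_def power2_eq_square power3_eq_cube)
  qed
  show "of_real (1 / curvature s u) * unit_normal s u = \<i> * velocity s u / of_real (2 * Im \<alpha>)"
    unfolding * unit_normal_def using assms(1) by simp
qed

lemma ext_approx_if_agree:
  assumes "eventually (\<lambda>\<epsilon>. g \<epsilon> = Some (f \<epsilon>)) (at 0)" "agree_to_order n f (\<lambda>_. z)"
  shows "ext_approx g z (\<lambda>\<epsilon>. \<epsilon> ^ n)"
proof -
  have "agree_to_order n (\<lambda>\<epsilon>. the (g \<epsilon>)) (\<lambda>_. z)"
    using assms(1) by (intro agree_to_order_cong[OF assms(2)]) (auto elim!: eventually_mono)
  with assms(1) show ?thesis
    unfolding ext_approx_def agree_to_order_def by (auto elim!: eventually_mono)
qed

text \<open>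
  With \<open>\<theta> = \<tau> / \<epsilon> = - \<alpha> + O(\<epsilon>^2)\<close> and \<open>\<eta> = \<rho> + O(\<epsilon>^2)\<close>, where \<open>\<rho> = 1 / sqrt 3\<close> is real, curvature and center
  are combinations of \<open>\<theta>\<close>, \<open>\<eta>\<close> and \<open>p\<close> by 1-Lipschitz maps, products and quotients with nonzero limit; \<open>\<rho>\<close>
  cancels.
\<close>

lemma sampling_asymptotics:
  fixes s :: "real \<Rightarrow> complex" and u :: real
  assumes "class_C 4 s" "velocity s u \<noteq> 0"
  shows "agree_to_order 2 (\<lambda>\<epsilon>. discrete_curvature (sampling s u \<epsilon>) 0) (\<lambda>_. \<bar>curvature s u\<bar>)"
    and "curvature s u \<noteq> 0 \<Longrightarrow> ext_approx (\<lambda>\<epsilon>. discrete_center (sampling s u \<epsilon>) 0)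
          (s u + of_real (1 / curvature s u) * unit_normal s u) (\<lambda>\<epsilon>. \<epsilon> ^ 2)"
    and "ext_approx (\<lambda>\<epsilon>. edge_point (sampling s u \<epsilon>) 0) (s u) (\<lambda>\<epsilon>. \<epsilon> ^ 3)"
proof -
  define l where "l = velocity s u"
  define \<alpha> where "\<alpha> = velocity (velocity s) u / (2 * l)"
  define \<rho> :: real where "\<rho> = 1 / sqrt 3"
  have \<rho>: "\<rho> > 0" by (simp add: \<rho>_def)
  have l: "l \<noteq> 0" using assms by (simp add: l_def)
  have \<rho>_eq: "1 / of_real (sqrt 3) = (of_real \<rho> :: complex)" by (simp add: \<rho>_def)
  obtain p \<tau> \<eta> \<eta>2 where jets: "jet2 p 0 0 0" "jet2 \<tau> 0 (- \<alpha>) 0" "jet2 \<eta> (of_real \<rho>) 0 \<eta>2"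
    and ev: "eventually (\<lambda>\<epsilon>. edge_point (sampling s u \<epsilon>) 0 = Some (s u + of_real \<epsilon> * l * p \<epsilon>) \<and>
      discrete_curvature_circle (sampling s u \<epsilon>) 0 = circle_through (s u + of_real \<epsilon> * l * p \<epsilon>)
        (Im (\<tau> \<epsilon> * cnj (\<eta> \<epsilon>)) / (\<epsilon> * cmod l)\<^sup>2) (\<i> * cnj (\<eta> \<epsilon> / (of_real \<epsilon> * l)))) (at 0)"
    by (rule eventually_four_point_circle[OF assms, folded l_def, folded \<alpha>_def, unfolded \<rho>_eq])
  have nz: "eventually (\<lambda>\<epsilon>::real. \<epsilon> \<noteq> 0) (at 0)"
    by (simp add: eventually_at_filter)
  have \<eta>_nz: "eventually (\<lambda>\<epsilon>. \<eta> \<epsilon> \<noteq> 0) (at 0)"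
    using jets(3)[THEN jet2_eventually_nonzero] \<rho> by simp
  define \<theta> where "\<theta> \<epsilon> = \<tau> \<epsilon> / of_real \<epsilon>" for \<epsilon> :: real
  have \<theta>: "agree_to_order 2 \<theta> (\<lambda>_. - \<alpha>)"
    unfolding \<theta>_def by (rule jet2_divide_parameter[OF jets(2)])
  have \<eta>: "agree_to_order 2 \<eta> (\<lambda>_. of_real \<rho>)"
    by (rule jet2_imp_agree_2[OF jets(3)])
  have cnj_\<eta>: "agree_to_order 2 (\<lambda>\<epsilon>. cnj (\<eta> \<epsilon>)) (\<lambda>_. of_real \<rho>)"
    using agree_to_order_lipschitz[OF \<eta>, of cnj] by (simp flip: complex_cnj_diff)
  have norm_\<eta>: "agree_to_order 2 (\<lambda>\<epsilon>. cmod (\<eta> \<epsilon>)) (\<lambda>_. \<rho>)"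
    using agree_to_order_lipschitz[OF \<eta>, of cmod] \<rho> by (simp add: norm_triangle_ineq3)
  have "agree_to_order 2 (\<lambda>\<epsilon>. \<theta> \<epsilon> * cnj (\<eta> \<epsilon>)) (\<lambda>_. - \<alpha> * of_real \<rho>)"
    by (rule agree_to_order_mult[OF \<theta> cnj_\<eta> _ tendsto_const tendsto_const]) simp
  from agree_to_order_lipschitz[OF this, of Im]
  have Im: "agree_to_order 2 (\<lambda>\<epsilon>. Im (\<theta> \<epsilon> * cnj (\<eta> \<epsilon>))) (\<lambda>_. - (Im \<alpha> * \<rho>))"
    using abs_Im_le_cmod by (simp flip: minus_complex.simps)
  have pl: "agree_to_order 3 (\<lambda>\<epsilon>. of_real \<epsilon> * l * p \<epsilon>) (\<lambda>_. 0)"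
  proof -
    have "((\<lambda>\<epsilon>. of_real \<epsilon> * l) \<longlongrightarrow> of_real 0 * l) (at 0)"
      by (intro tendsto_intros)
    moreover have "p \<in> O[at 0](\<lambda>\<epsilon>. of_real (\<epsilon> ^ 3))"
      using jets(1) by (simp add: jet2_def agree_to_order_def quad_def)
    ultimately show ?thesis
      unfolding agree_to_order_def using mult_bounded_bigo by (simp add: mult.commute) blast
  qed
  show "ext_approx (\<lambda>\<epsilon>. edge_point (sampling s u \<epsilon>) 0) (s u) (\<lambda>\<epsilon>. \<epsilon> ^ 3)"
    using ev by (intro ext_approx_if_agree[where f = "\<lambda>\<epsilon>. s u + of_real \<epsilon> * l * p \<epsilon>"])
      (use agree_to_order_add[OF agree_to_order_refl pl, of "\<lambda>_. s u"] in \<open>auto elim!: eventually_mono\<close>)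
  have curv: "\<bar>curvature s u\<bar> = 2 * \<bar>- (Im \<alpha> * \<rho>)\<bar> / (cmod l * \<rho>)"
    using curvature_normal_eq(1)[OF assms(2)] \<rho> l by (simp add: \<alpha>_def l_def abs_mult)
  have "agree_to_order 2 (\<lambda>\<epsilon>. 2 * \<bar>Im (\<theta> \<epsilon> * cnj (\<eta> \<epsilon>))\<bar>) (\<lambda>_. 2 * \<bar>- (Im \<alpha> * \<rho>)\<bar>)"
    using agree_to_order_lipschitz[OF Im, of abs]
    by (intro agree_to_order_mult[OF agree_to_order_refl _ _ tendsto_const tendsto_const]) auto
  moreover have "agree_to_order 2 (\<lambda>\<epsilon>. cmod l * cmod (\<eta> \<epsilon>)) (\<lambda>_. cmod l * \<rho>)"
    by (rule agree_to_order_mult[OF agree_to_order_refl norm_\<eta> _ tendsto_const tendsto_const]) simp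
  ultimately have "agree_to_order 2 (\<lambda>\<epsilon>. 2 * \<bar>Im (\<theta> \<epsilon> * cnj (\<eta> \<epsilon>))\<bar> / (cmod l * cmod (\<eta> \<epsilon>)))
      (\<lambda>_. 2 * \<bar>- (Im \<alpha> * \<rho>)\<bar> / (cmod l * \<rho>))"
    using \<rho> l by (intro agree_to_order_divide[OF _ _ _ tendsto_const tendsto_const]) simp_all
  moreover have "eventually (\<lambda>\<epsilon>. discrete_curvature (sampling s u \<epsilon>) 0
      = 2 * \<bar>Im (\<theta> \<epsilon> * cnj (\<eta> \<epsilon>))\<bar> / (cmod l * cmod (\<eta> \<epsilon>))) (at 0)"
    using ev nz \<eta>_nz
  proof eventually_elim
    case (elim \<epsilon>)
    then show ?case
      using circle_through_scaled_curvature[OF _ l] by (simp only: discrete_curvature_def \<theta>_def simp_thms)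
  qed
  ultimately show "agree_to_order 2 (\<lambda>\<epsilon>. discrete_curvature (sampling s u \<epsilon>) 0) (\<lambda>_. \<bar>curvature s u\<bar>)"
    unfolding curv by (rule agree_to_order_cong)
  assume "curvature s u \<noteq> 0"
  then have \<alpha>: "Im \<alpha> \<noteq> 0"
    using curvature_normal_eq(1)[OF assms(2)] by (auto simp: \<alpha>_def l_def)
  have Im_nz: "eventually (\<lambda>\<epsilon>. Im (\<theta> \<epsilon> * cnj (\<eta> \<epsilon>)) \<noteq> 0) (at 0)"
    by (rule tendsto_imp_eventually_ne[OF agree_to_order_tendsto[OF Im _ tendsto_const]]) (use \<alpha> \<rho> in auto)
  let ?m = "\<lambda>\<epsilon>. (s u + of_real \<epsilon> * l * p \<epsilon>) - \<i> * l * (cnj (\<eta> \<epsilon>) / of_real (2 * Im (\<theta> \<epsilon> * cnj (\<eta> \<epsilon>))))"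
  show "ext_approx (\<lambda>\<epsilon>. discrete_center (sampling s u \<epsilon>) 0)
          (s u + of_real (1 / curvature s u) * unit_normal s u) (\<lambda>\<epsilon>. \<epsilon> ^ 2)"
  proof (rule ext_approx_if_agree)
    show "eventually (\<lambda>\<epsilon>. discrete_center (sampling s u \<epsilon>) 0 = Some (?m \<epsilon>)) (at 0)"
      using ev nz \<eta>_nz Im_nz
    proof eventually_elim
      case (elim \<epsilon>)
      then show ?case
        using circle_through_scaled_center[OF _ l] by (simp only: discrete_center_def \<theta>_def simp_thms)
    qed
    have "agree_to_order 2 (\<lambda>\<epsilon>. of_real (2 * Im (\<theta> \<epsilon> * cnj (\<eta> \<epsilon>))) :: complex) (\<lambda>_. of_real (2 * - (Im \<alpha> * \<rho>)))"
    proof -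
      have "agree_to_order 2 (\<lambda>\<epsilon>. of_real (Im (\<theta> \<epsilon> * cnj (\<eta> \<epsilon>))) :: complex) (\<lambda>_. of_real (- (Im \<alpha> * \<rho>)))"
        by (rule agree_to_order_lipschitz[OF Im]) (simp flip: of_real_diff)
      from agree_to_order_mult[OF agree_to_order_refl[of 2 "\<lambda>_. 2"] this _ tendsto_const tendsto_const]
      show ?thesis by simp
    qed
    then have "agree_to_order 2 (\<lambda>\<epsilon>. cnj (\<eta> \<epsilon>) / of_real (2 * Im (\<theta> \<epsilon> * cnj (\<eta> \<epsilon>))))
        (\<lambda>_. of_real \<rho> / of_real (2 * - (Im \<alpha> * \<rho>)))"
      using \<alpha> \<rho> by (intro agree_to_order_divide[OF cnj_\<eta> _ _ tendsto_const tendsto_const]) simp_all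
    then have "agree_to_order 2 (\<lambda>\<epsilon>. \<i> * l * (cnj (\<eta> \<epsilon>) / of_real (2 * Im (\<theta> \<epsilon> * cnj (\<eta> \<epsilon>)))))
        (\<lambda>_. \<i> * l * (of_real \<rho> / of_real (2 * - (Im \<alpha> * \<rho>))))"
      by (intro agree_to_order_mult[OF agree_to_order_refl _ _ tendsto_const tendsto_const]) simp_all
    moreover have "agree_to_order 2 (\<lambda>\<epsilon>. s u + of_real \<epsilon> * l * p \<epsilon>) (\<lambda>_. s u + 0)"
    proof (rule agree_to_order_add[OF agree_to_order_refl])
      have "((\<lambda>\<epsilon>. of_real \<epsilon> * l) \<longlongrightarrow> of_real 0 * l) (at 0)"
        by (intro tendsto_intros)
      with jet2_imp_agree_2[OF jets(1)] show "agree_to_order 2 (\<lambda>\<epsilon>. of_real \<epsilon> * l * p \<epsilon>) (\<lambda>_. 0)"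
        unfolding agree_to_order_def using mult_bounded_bigo by (simp add: mult.commute) blast
    qed
    ultimately have "agree_to_order 2 ?m (\<lambda>_. (s u + 0) - \<i> * l * (of_real \<rho> / of_real (2 * - (Im \<alpha> * \<rho>))))"
      by (intro agree_to_order_diff)
    moreover have "(s u + 0) - \<i> * l * (of_real \<rho> / of_real (2 * - (Im \<alpha> * \<rho>)))
        = s u + of_real (1 / curvature s u) * unit_normal s u"
      unfolding curvature_normal_eq(2)[OF assms(2)] using \<rho> by (simp add: l_def \<alpha>_def)
    ultimately show "agree_to_order 2 ?m (\<lambda>_. s u + of_real (1 / curvature s u) * unit_normal s u)"
      by simp
  qed
qed

theorem theorem7:
  shows "\<exists>k::nat. \<forall>(s::real \<Rightarrow> complex) (u::real).
    class_C k s \<and> regular_curve s \<longrightarrow>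
      (\<lambda>\<epsilon>. discrete_curvature (sampling s u \<epsilon>) 0 - \<bar>curvature s u\<bar>) \<in> O[at 0](\<lambda>\<epsilon>. \<epsilon> ^ 2)
    \<and> (curvature s u \<noteq> 0 \<longrightarrow>
        ext_approx (\<lambda>\<epsilon>. discrete_center (sampling s u \<epsilon>) 0)
          (s u + of_real (1 / curvature s u) * unit_normal s u) (\<lambda>\<epsilon>. \<epsilon> ^ 2))
    \<and> ext_approx (\<lambda>\<epsilon>. edge_point (sampling s u \<epsilon>) 0) (s u) (\<lambda>\<epsilon>. \<epsilon> ^ 3)"
proof (intro exI[of _ 4] allI impI conjI)
  fix s :: "real \<Rightarrow> complex" and u :: real
  (* Four derivatives: the jets contain the third one, and the remainder before division by eps is O(eps^4). *)
  assume "class_C 4 s \<and> regular_curve s"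
  then have s: "class_C 4 s" "velocity s u \<noteq> 0"
    by (auto simp: regular_curve_def)
  show "(\<lambda>\<epsilon>. discrete_curvature (sampling s u \<epsilon>) 0 - \<bar>curvature s u\<bar>) \<in> O[at 0](\<lambda>\<epsilon>. \<epsilon> ^ 2)"
    using sampling_asymptotics(1)[OF s] by (simp add: agree_to_order_def)
  show "ext_approx (\<lambda>\<epsilon>. edge_point (sampling s u \<epsilon>) 0) (s u) (\<lambda>\<epsilon>. \<epsilon> ^ 3)"
    by (rule sampling_asymptotics(3)[OF s])
  assume "curvature s u \<noteq> 0"
  then show "ext_approx (\<lambda>\<epsilon>. discrete_center (sampling s u \<epsilon>) 0)
          (s u + of_real (1 / curvature s u) * unit_normal s u) (\<lambda>\<epsilon>. \<epsilon> ^ 2)"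
    by (rule sampling_asymptotics(2)[OF s])
qed

end
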